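(* Let $k\in\mathbb{N}$, let $\mathscr{P},A$ be nonempty finite sets, and let $\mathbf{U}$ be a class of $k$-DAG-decomposable $(2^{\mathscr{P}},A)$-graphs. For every $\mu$-calculus sentence $\phi$ there is an alternation-free $\mu$-calculus sentence $\psi$ such that $L_{\mathbf{U}}(\psi)=L_{\mathbf{U}}(\phi)$.
   Context: A $(2^{\mathscr{P}},A)$-graph is $(V,(E_a)_{a\in A},v_I,\lambda)$ with $V$ at most countable, $E_a\subseteq V\times V$, $v_I\in V$, $\lambda:V\to 2^{\mathscr{P}}$. A feedback vertex set of a finite graph is a set $F\subseteq V$ whose removal leaves an acyclic graph (a set of finite DAGs); a finite graph is $k$-DAG-decomposable iff the minimal cardinality of a feedback vertex set is $k$. $\mu$-calculus: formulas $\phi::= X\mid p\mid\neg p\mid\phi\wedge\phi\mid\phi\vee\phi\mid[a]\phi\mid\langle a\rangle\phi\mid\mu X.\phi\mid\nu X.\phi$ ($X$ a variable, $p\in\mathscr{P}$, $a\in A$) with the standard semantics ($[a]$: all $E_a$-successors; $\langle a\rangle$: some $E_a$-successor; $\mu,\nu$: least/greatest fixpoints). For a sentence $\phi$, $L_{\mathbf{U}}(\phi)$ is the set of graphs in $\mathbf{U}$ whose source satisfies $\phi$. Alternation hierarchy: $\Sigma_0=\Pi_0$ = fixpoint-free formulas; $\Sigma_{n+1}$ is the smallest set containing $\Sigma_n\cup\Pi_n$ closed under $\wedge,\vee,[a],\langle a\rangle$, $\mu X.$, and substitution $\phi[\psi/X]$ (when no free variable of $\psi$ gets bound in $\phi$);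 $\Pi_{n+1}$ likewise with $\nu$; $\Delta_n=\Sigma_n\cap\Pi_n$. A formula is alternation-free iff it lies in $\Delta_2$. *)

theory Defs
  imports Main "HOL-Library.Countable_Set"
begin

text \<open>The finite sets of atomic propositions and of actions are the types \<open>'p\<close> and \<open>'a\<close>
  (instantiated to class \<open>finite\<close> where this matters).  The label function is only
  meaningful on \<open>verts\<close>.\<close>

record ('v, 'p, 'a) graph =
  verts :: "'v set"
  edges :: "'a \<Rightarrow> ('v \<times> 'v) set"
  source :: 'v
  label :: "'v \<Rightarrow> 'p set"

definition is_graph :: "('v, 'p, 'a) graph \<Rightarrow> bool" where
  "is_graph G \<longleftrightarrow>
     countable (verts G) \<and> (\<forall>a. edges G a \<subseteq> verts G \<times> verts G) \<and> source G \<in> verts G"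

text \<open>Cycles may mix edges of different actions; self-loops are cycles.\<close>

definition feedback_vertex_set :: "('v, 'p, 'a) graph \<Rightarrow> 'v set \<Rightarrow> bool" where
  "feedback_vertex_set G F \<longleftrightarrow>
     F \<subseteq> verts G \<and>
     acyclic ((\<Union>a. edges G a) \<inter> (verts G - F) \<times> (verts G - F))"

definition dag_decomposable :: "nat \<Rightarrow> ('v, 'p, 'a) graph \<Rightarrow> bool" where
  "dag_decomposable k G \<longleftrightarrow>
     finite (verts G) \<and>
     (\<exists>F. feedback_vertex_set G F \<and> card F = k) \<and>
     (\<forall>F. feedback_vertex_set G F \<longrightarrow> k \<le> card F)"

datatype ('p, 'a) fml =
    Var nat
  | Prop 'p
  | NProp 'p
  | Conj "('p, 'a) fml" "('p, 'a) fml"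
  | Disj "('p, 'a) fml" "('p, 'a) fml"
  | Box 'a "('p, 'a) fml"
  | Dia 'a "('p, 'a) fml"
  | Mu nat "('p, 'a) fml"
  | Nu nat "('p, 'a) fml"

primrec fv :: "('p, 'a) fml \<Rightarrow> nat set" where
  "fv (Var X) = {X}"
| "fv (Prop p) = {}"
| "fv (NProp p) = {}"
| "fv (Conj \<phi> \<psi>) = fv \<phi> \<union> fv \<psi>"
| "fv (Disj \<phi> \<psi>) = fv \<phi> \<union> fv \<psi>"
| "fv (Box a \<phi>) = fv \<phi>"
| "fv (Dia a \<phi>) = fv \<phi>"
| "fv (Mu X \<phi>) = fv \<phi> - {X}"
| "fv (Nu X \<phi>) = fv \<phi> - {X}"

definition sentence :: "('p, 'a) fml \<Rightarrow> bool" where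
  "sentence \<phi> \<longleftrightarrow> fv \<phi> = {}"

text \<open>Variables are clipped to \<open>verts G\<close>, so that denotations are sets of vertices and
  \<open>lfp\<close>/\<open>gfp\<close>, which range over all sets of type \<open>'v set\<close>, coincide with the extremal
  fixpoints over the subsets of \<open>verts G\<close>.\<close>

primrec sem :: "('v, 'p, 'a) graph \<Rightarrow> ('p, 'a) fml \<Rightarrow> (nat \<Rightarrow> 'v set) \<Rightarrow> 'v set" where
  "sem G (Var X) \<rho> = \<rho> X \<inter> verts G"
| "sem G (Prop p) \<rho> = {v \<in> verts G. p \<in> label G v}"
| "sem G (NProp p) \<rho> = {v \<in> verts G. p \<notin> label G v}"
| "sem G (Conj \<phi> \<psi>) \<rho> = sem G \<phi> \<rho> \<inter> sem G \<psi> \<rho>"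
| "sem G (Disj \<phi> \<psi>) \<rho> = sem G \<phi> \<rho> \<union> sem G \<psi> \<rho>"
| "sem G (Box a \<phi>) \<rho> = {v \<in> verts G. \<forall>w. (v, w) \<in> edges G a \<longrightarrow> w \<in> sem G \<phi> \<rho>}"
| "sem G (Dia a \<phi>) \<rho> = {v \<in> verts G. \<exists>w. (v, w) \<in> edges G a \<and> w \<in> sem G \<phi> \<rho>}"
| "sem G (Mu X \<phi>) \<rho> = lfp (\<lambda>S. sem G \<phi> (\<rho>(X := S)))"
| "sem G (Nu X \<phi>) \<rho> = gfp (\<lambda>S. sem G \<phi> (\<rho>(X := S)))"

lemma sem_mono: "(\<And>X. \<rho> X \<subseteq> \<rho>' X) \<Longrightarrow> sem G \<phi> \<rho> \<subseteq> sem G \<phi> \<rho>'"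
proof (induction \<phi> arbitrary: \<rho> \<rho>')
  case (Mu X \<phi>)
  show ?case unfolding sem.simps by (rule lfp_mono) (rule Mu.IH, simp add: Mu.prems)
next
  case (Nu X \<phi>)
  show ?case unfolding sem.simps by (rule gfp_mono) (rule Nu.IH, simp add: Nu.prems)
next
  case (Conj \<phi> \<psi>)
  show ?case using Conj.IH(1)[of \<rho> \<rho>'] Conj.IH(2)[of \<rho> \<rho>'] Conj.prems by auto
next
  case (Disj \<phi> \<psi>)
  show ?case using Disj.IH(1)[of \<rho> \<rho>'] Disj.IH(2)[of \<rho> \<rho>'] Disj.prems by auto
next
  case (Box a \<phi>)
  show ?case using Box.IH[of \<rho> \<rho>'] Box.prems by auto
next
  case (Dia a \<phi>)
  show ?case using Dia.IH[of \<rho> \<rho>'] Dia.prems by auto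
qed auto

lemma mono_sem: "mono (\<lambda>S. sem G \<phi> (\<rho>(X := S)))"
  by (intro monoI sem_mono) simp

lemma sem_subset_verts: "sem G \<phi> \<rho> \<subseteq> verts G"
proof (induction \<phi> arbitrary: \<rho>)
  case (Mu X \<phi>)
  show ?case by (simp add: lfp_lowerbound Mu.IH)
next
  case (Nu X \<phi>)
  show ?case unfolding sem.simps by (rule gfp_least) (use Nu.IH in blast)
qed (auto dest: subsetD)

text \<open>For sentences the valuation is irrelevant; the empty one is used.\<close>

definition lang :: "('v, 'p, 'a) graph set \<Rightarrow> ('p, 'a) fml \<Rightarrow> ('v, 'p, 'a) graph set" where
  "lang U \<phi> = {G \<in> U. source G \<in> sem G \<phi> (\<lambda>_. {})}"

primrec fixpoint_free :: "('p, 'a) fml \<Rightarrow> bool" where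
  "fixpoint_free (Var X) \<longleftrightarrow> True"
| "fixpoint_free (Prop p) \<longleftrightarrow> True"
| "fixpoint_free (NProp p) \<longleftrightarrow> True"
| "fixpoint_free (Conj \<phi> \<psi>) \<longleftrightarrow> fixpoint_free \<phi> \<and> fixpoint_free \<psi>"
| "fixpoint_free (Disj \<phi> \<psi>) \<longleftrightarrow> fixpoint_free \<phi> \<and> fixpoint_free \<psi>"
| "fixpoint_free (Box a \<phi>) \<longleftrightarrow> fixpoint_free \<phi>"
| "fixpoint_free (Dia a \<phi>) \<longleftrightarrow> fixpoint_free \<phi>"
| "fixpoint_free (Mu X \<phi>) \<longleftrightarrow> False"
| "fixpoint_free (Nu X \<phi>) \<longleftrightarrow> False"

text \<open>\<open>subst \<phi> X \<psi>\<close> is \<open>\<phi>[\<psi>/X]\<close>: literal replacement of the free occurrences of \<open>X\<close>, without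
  renaming.  It is only used under \<open>free_for \<psi> X \<phi>\<close>, which says that this captures no free
  variable of \<open>\<psi>\<close>.\<close>

primrec subst :: "('p, 'a) fml \<Rightarrow> nat \<Rightarrow> ('p, 'a) fml \<Rightarrow> ('p, 'a) fml" where
  "subst (Var Y) X \<psi> = (if Y = X then \<psi> else Var Y)"
| "subst (Prop p) X \<psi> = Prop p"
| "subst (NProp p) X \<psi> = NProp p"
| "subst (Conj \<phi>1 \<phi>2) X \<psi> = Conj (subst \<phi>1 X \<psi>) (subst \<phi>2 X \<psi>)"
| "subst (Disj \<phi>1 \<phi>2) X \<psi> = Disj (subst \<phi>1 X \<psi>) (subst \<phi>2 X \<psi>)"
| "subst (Box a \<phi>) X \<psi> = Box a (subst \<phi> X \<psi>)"
| "subst (Dia a \<phi>) X \<psi> = Dia a (subst \<phi> X \<psi>)"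
| "subst (Mu Y \<phi>) X \<psi> = (if Y = X then Mu Y \<phi> else Mu Y (subst \<phi> X \<psi>))"
| "subst (Nu Y \<phi>) X \<psi> = (if Y = X then Nu Y \<phi> else Nu Y (subst \<phi> X \<psi>))"

primrec free_for :: "('p, 'a) fml \<Rightarrow> nat \<Rightarrow> ('p, 'a) fml \<Rightarrow> bool" where
  "free_for \<psi> X (Var Y) \<longleftrightarrow> True"
| "free_for \<psi> X (Prop p) \<longleftrightarrow> True"
| "free_for \<psi> X (NProp p) \<longleftrightarrow> True"
| "free_for \<psi> X (Conj \<phi>1 \<phi>2) \<longleftrightarrow> free_for \<psi> X \<phi>1 \<and> free_for \<psi> X \<phi>2"
| "free_for \<psi> X (Disj \<phi>1 \<phi>2) \<longleftrightarrow> free_for \<psi> X \<phi>1 \<and> free_for \<psi> X \<phi>2"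
| "free_for \<psi> X (Box a \<phi>) \<longleftrightarrow> free_for \<psi> X \<phi>"
| "free_for \<psi> X (Dia a \<phi>) \<longleftrightarrow> free_for \<psi> X \<phi>"
| "free_for \<psi> X (Mu Y \<phi>) \<longleftrightarrow> X \<notin> fv (Mu Y \<phi>) \<or> (Y \<notin> fv \<psi> \<and> free_for \<psi> X \<phi>)"
| "free_for \<psi> X (Nu Y \<phi>) \<longleftrightarrow> X \<notin> fv (Nu Y \<phi>) \<or> (Y \<notin> fv \<psi> \<and> free_for \<psi> X \<phi>)"

text \<open>One step of the hierarchy above the base set \<open>B\<close>; the binder \<open>fp\<close> is \<open>Mu\<close> or \<open>Nu\<close>.\<close>

inductive_set fp_closure ::
    "(nat \<Rightarrow> ('p, 'a) fml \<Rightarrow> ('p, 'a) fml) \<Rightarrow> ('p, 'a) fml set \<Rightarrow> ('p, 'a) fml set"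
  for fp :: "nat \<Rightarrow> ('p, 'a) fml \<Rightarrow> ('p, 'a) fml" and B :: "('p, 'a) fml set" where
  base: "\<phi> \<in> B \<Longrightarrow> \<phi> \<in> fp_closure fp B"
| conj: "\<phi> \<in> fp_closure fp B \<Longrightarrow> \<psi> \<in> fp_closure fp B \<Longrightarrow> Conj \<phi> \<psi> \<in> fp_closure fp B"
| disj: "\<phi> \<in> fp_closure fp B \<Longrightarrow> \<psi> \<in> fp_closure fp B \<Longrightarrow> Disj \<phi> \<psi> \<in> fp_closure fp B"
| box: "\<phi> \<in> fp_closure fp B \<Longrightarrow> Box a \<phi> \<in> fp_closure fp B"
| dia: "\<phi> \<in> fp_closure fp B \<Longrightarrow> Dia a \<phi> \<in> fp_closure fp B"
| fixp: "\<phi> \<in> fp_closure fp B \<Longrightarrow> fp X \<phi> \<in> fp_closure fp B"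
| subst: "\<phi> \<in> fp_closure fp B \<Longrightarrow> \<psi> \<in> fp_closure fp B \<Longrightarrow> free_for \<psi> X \<phi> \<Longrightarrow>
    subst \<phi> X \<psi> \<in> fp_closure fp B"

fun Sigma_level :: "nat \<Rightarrow> ('p, 'a) fml set"
  and Pi_level :: "nat \<Rightarrow> ('p, 'a) fml set" where
  "Sigma_level 0 = {\<phi>. fixpoint_free \<phi>}"
| "Pi_level 0 = {\<phi>. fixpoint_free \<phi>}"
| "Sigma_level (Suc n) = fp_closure Mu (Sigma_level n \<union> Pi_level n)"
| "Pi_level (Suc n) = fp_closure Nu (Sigma_level n \<union> Pi_level n)"

definition Delta_level :: "nat \<Rightarrow> ('p, 'a) fml set" where
  "Delta_level n = Sigma_level n \<inter> Pi_level n"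

definition alternation_free :: "('p, 'a) fml \<Rightarrow> bool" where
  "alternation_free \<phi> \<longleftrightarrow> \<phi> \<in> Delta_level 2"

end

theory Submission
  imports Defs
begin

text \<open>
  By structural induction, the value of a formula \<open>\<phi>\<close> is expressed through a finite system of
  equations in which every state is guarded by a modality, such that one solution of the system
  consists of formulas without genuine alternation.  The critical step is \<open>\<mu>X. \<phi>\<close>; \<open>\<nu>\<close> follows by
  duality.  If \<open>hs A\<close> is the solution of the system of \<open>\<phi>\<close> at \<open>X = A\<close>, the least fixpoint is
  approximated by stages: given a family \<open>S\<close> and the set \<open>A\<close> that it induces for \<open>X\<close>, the next stage is
  the least family above \<open>S\<close> and \<open>hs A\<close> that is closed under the system with \<open>X\<close> tied to its own
  value.  Suppose \<open>S\<close> is closed and \<open>hs A\<close> adds nothing to it on the feedback vertex set.  As the rest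
  of the graph is acyclic and states are guarded, well-founded induction shows that \<open>hs A\<close> adds
  nothing at all, so the least fixpoint is reached.  Hence each further stage gains a pair of
  a feedback vertex and a state, and a number of stages depending only on \<open>k\<close> and \<open>\<phi>\<close> suffices.
  Every stage is a pure \<open>\<mu>\<close>-system over the previous one, so stacking them creates no alternation.
\<close>

section \<open>Syntax\<close>

primrec bv :: "('p, 'a) fml \<Rightarrow> nat set" where
  "bv (Var X) = {}"
| "bv (Prop p) = {}"
| "bv (NProp p) = {}"
| "bv (Conj \<phi> \<psi>) = bv \<phi> \<union> bv \<psi>"
| "bv (Disj \<phi> \<psi>) = bv \<phi> \<union> bv \<psi>"
| "bv (Box a \<phi>) = bv \<phi>"
| "bv (Dia a \<phi>) = bv \<phi>"
| "bv (Mu X \<phi>) = insert X (bv \<phi>)"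
| "bv (Nu X \<phi>) = insert X (bv \<phi>)"

text \<open>Collects the variables with a free occurrence inside some \<open>Mu\<close>-subformula;
  \<open>nuv\<close> is the counterpart for \<open>Nu\<close>. Both record how an inner fixpoint
  depends on an outer one.\<close>

primrec muv :: "('p, 'a) fml \<Rightarrow> nat set" where
  "muv (Var X) = {}"
| "muv (Prop p) = {}"
| "muv (NProp p) = {}"
| "muv (Conj \<phi> \<psi>) = muv \<phi> \<union> muv \<psi>"
| "muv (Disj \<phi> \<psi>) = muv \<phi> \<union> muv \<psi>"
| "muv (Box a \<phi>) = muv \<phi>"
| "muv (Dia a \<phi>) = muv \<phi>"
| "muv (Mu X \<phi>) = fv \<phi> - {X}"
| "muv (Nu X \<phi>) = muv \<phi> - {X}"

primrec nuv :: "('p, 'a) fml \<Rightarrow> nat set" where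
  "nuv (Var X) = {}"
| "nuv (Prop p) = {}"
| "nuv (NProp p) = {}"
| "nuv (Conj \<phi> \<psi>) = nuv \<phi> \<union> nuv \<psi>"
| "nuv (Disj \<phi> \<psi>) = nuv \<phi> \<union> nuv \<psi>"
| "nuv (Box a \<phi>) = nuv \<phi>"
| "nuv (Dia a \<phi>) = nuv \<phi>"
| "nuv (Mu X \<phi>) = nuv \<phi> - {X}"
| "nuv (Nu X \<phi>) = fv \<phi> - {X}"

text \<open>Alternation-freeness in the style of Emerson and Lei: no fixpoint variable is free
  inside a fixpoint formula of the opposite kind within its scope. Unlike membership in
  \<open>Delta_level 2\<close>, this can be checked by recursion and is easily tracked through
  substitutions.\<close>

primrec stratified :: "('p, 'a) fml \<Rightarrow> bool" where
  "stratified (Var X) \<longleftrightarrow> True"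
| "stratified (Prop p) \<longleftrightarrow> True"
| "stratified (NProp p) \<longleftrightarrow> True"
| "stratified (Conj \<phi> \<psi>) \<longleftrightarrow> stratified \<phi> \<and> stratified \<psi>"
| "stratified (Disj \<phi> \<psi>) \<longleftrightarrow> stratified \<phi> \<and> stratified \<psi>"
| "stratified (Box a \<phi>) \<longleftrightarrow> stratified \<phi>"
| "stratified (Dia a \<phi>) \<longleftrightarrow> stratified \<phi>"
| "stratified (Mu X \<phi>) \<longleftrightarrow> stratified \<phi> \<and> X \<notin> nuv \<phi>"
| "stratified (Nu X \<phi>) \<longleftrightarrow> stratified \<phi> \<and> X \<notin> muv \<phi>"

text \<open>Applied to \<open>dual \<phi>\<close>, this says that \<open>\<phi>\<close> is a pure
  \<mu>-formula.\<close>

primrec mu_free :: "('p, 'a) fml \<Rightarrow> bool" where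
  "mu_free (Var X) \<longleftrightarrow> True"
| "mu_free (Prop p) \<longleftrightarrow> True"
| "mu_free (NProp p) \<longleftrightarrow> True"
| "mu_free (Conj \<phi> \<psi>) \<longleftrightarrow> mu_free \<phi> \<and> mu_free \<psi>"
| "mu_free (Disj \<phi> \<psi>) \<longleftrightarrow> mu_free \<phi> \<and> mu_free \<psi>"
| "mu_free (Box a \<phi>) \<longleftrightarrow> mu_free \<phi>"
| "mu_free (Dia a \<phi>) \<longleftrightarrow> mu_free \<phi>"
| "mu_free (Mu X \<phi>) \<longleftrightarrow> False"
| "mu_free (Nu X \<phi>) \<longleftrightarrow> mu_free \<phi>"

primrec dual :: "('p, 'a) fml \<Rightarrow> ('p, 'a) fml" where
  "dual (Var X) = Var X"
| "dual (Prop p) = NProp p"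
| "dual (NProp p) = Prop p"
| "dual (Conj \<phi> \<psi>) = Disj (dual \<phi>) (dual \<psi>)"
| "dual (Disj \<phi> \<psi>) = Conj (dual \<phi>) (dual \<psi>)"
| "dual (Box a \<phi>) = Dia a (dual \<phi>)"
| "dual (Dia a \<phi>) = Box a (dual \<phi>)"
| "dual (Mu X \<phi>) = Nu X (dual \<phi>)"
| "dual (Nu X \<phi>) = Mu X (dual \<phi>)"

primrec msubst :: "(nat \<Rightarrow> ('p, 'a) fml) \<Rightarrow> ('p, 'a) fml \<Rightarrow> ('p, 'a) fml" where
  "msubst \<sigma> (Var X) = \<sigma> X"
| "msubst \<sigma> (Prop p) = Prop p"
| "msubst \<sigma> (NProp p) = NProp p"
| "msubst \<sigma> (Conj \<phi> \<psi>) = Conj (msubst \<sigma> \<phi>) (msubst \<sigma> \<psi>)"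
| "msubst \<sigma> (Disj \<phi> \<psi>) = Disj (msubst \<sigma> \<phi>) (msubst \<sigma> \<psi>)"
| "msubst \<sigma> (Box a \<phi>) = Box a (msubst \<sigma> \<phi>)"
| "msubst \<sigma> (Dia a \<phi>) = Dia a (msubst \<sigma> \<phi>)"
| "msubst \<sigma> (Mu X \<phi>) = Mu X (msubst (\<sigma>(X := Var X)) \<phi>)"
| "msubst \<sigma> (Nu X \<phi>) = Nu X (msubst (\<sigma>(X := Var X)) \<phi>)"

text \<open>Capture is excluded by disjointness of names, which is coarser than tracking the binders
  above each occurrence but easy to establish. The disjunct \<open>\<sigma> Y = Var Y\<close>
  exempts variables that stay unchanged.\<close>

definition capture_free :: "(nat \<Rightarrow> ('p, 'a) fml) \<Rightarrow> ('p, 'a) fml \<Rightarrow> bool" where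
  "capture_free \<sigma> \<phi> \<longleftrightarrow> (\<forall>Y\<in>fv \<phi>. \<sigma> Y = Var Y \<or> bv \<phi> \<inter> fv (\<sigma> Y) = {})"

lemma finite_fv: "finite (fv \<phi>)"
  by (induction \<phi>) auto

lemma finite_bv: "finite (bv \<phi>)"
  by (induction \<phi>) auto

lemma muv_subset_fv: "muv \<phi> \<subseteq> fv \<phi>"
  by (induction \<phi>) auto

lemma nuv_subset_fv: "nuv \<phi> \<subseteq> fv \<phi>"
  by (induction \<phi>) auto

lemma dual_dual [simp]: "dual (dual \<phi>) = \<phi>"
  by (induction \<phi>) auto

lemma fv_dual [simp]: "fv (dual \<phi>) = fv \<phi>"
  by (induction \<phi>) auto

lemma bv_dual [simp]: "bv (dual \<phi>) = bv \<phi>"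
  by (induction \<phi>) auto

lemma muv_dual [simp]: "muv (dual \<phi>) = nuv \<phi>"
  by (induction \<phi>) auto

lemma nuv_dual [simp]: "nuv (dual \<phi>) = muv \<phi>"
  by (induction \<phi>) auto

lemma stratified_dual [simp]: "stratified (dual \<phi>) = stratified \<phi>"
  by (induction \<phi>) auto

lemma nuv_eq_empty: "mu_free (dual \<phi>) \<Longrightarrow> nuv \<phi> = {}"
  by (induction \<phi>) auto

lemma stratified_if_mu_free_dual: "mu_free (dual \<phi>) \<Longrightarrow> stratified \<phi>"
  by (induction \<phi>) (auto simp: nuv_eq_empty)

section \<open>Variables and stratification under simultaneous substitution\<close>

lemma fv_msubst: "fv (msubst \<sigma> \<phi>) \<subseteq> (\<Union>Y\<in>fv \<phi>. fv (\<sigma> Y))"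
proof (induction \<phi> arbitrary: \<sigma>)
  case (Mu X \<phi>)
  show ?case by (auto dest!: subsetD[OF Mu.IH] split: if_splits)
next
  case (Nu X \<phi>)
  show ?case by (auto dest!: subsetD[OF Nu.IH] split: if_splits)
qed fastforce+

lemma bv_msubst: "bv (msubst \<sigma> \<phi>) \<subseteq> bv \<phi> \<union> (\<Union>Y\<in>fv \<phi>. bv (\<sigma> Y))"
proof (induction \<phi> arbitrary: \<sigma>)
  case (Mu X \<phi>)
  show ?case by (auto dest!: subsetD[OF Mu.IH] split: if_splits)
next
  case (Nu X \<phi>)
  show ?case by (auto dest!: subsetD[OF Nu.IH] split: if_splits)
qed fastforce+

lemma nuv_msubst:
  "nuv (msubst \<sigma> \<phi>) \<subseteq> (\<Union>Y\<in>fv \<phi>. nuv (\<sigma> Y)) \<union> (\<Union>Y\<in>nuv \<phi>. fv (\<sigma> Y))"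
proof (induction \<phi> arbitrary: \<sigma>)
  case (Mu X \<phi>)
  show ?case by (auto dest!: subsetD[OF Mu.IH] split: if_splits)
next
  case (Nu X \<phi>)
  show ?case by (auto dest!: subsetD[OF fv_msubst] split: if_splits)
qed fastforce+

lemma muv_msubst:
  "muv (msubst \<sigma> \<phi>) \<subseteq> (\<Union>Y\<in>fv \<phi>. muv (\<sigma> Y)) \<union> (\<Union>Y\<in>muv \<phi>. fv (\<sigma> Y))"
proof (induction \<phi> arbitrary: \<sigma>)
  case (Nu X \<phi>)
  show ?case by (auto dest!: subsetD[OF Nu.IH] split: if_splits)
next
  case (Mu X \<phi>)
  show ?case by (auto dest!: subsetD[OF fv_msubst] split: if_splits)
qed fastforce+

lemma capture_free_ConjD:
  "capture_free \<sigma> (Conj \<phi> \<psi>) \<Longrightarrow> capture_free \<sigma> \<phi> \<and> capture_free \<sigma> \<psi>"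
  by (auto simp: capture_free_def)

lemma capture_free_DisjD:
  "capture_free \<sigma> (Disj \<phi> \<psi>) \<Longrightarrow> capture_free \<sigma> \<phi> \<and> capture_free \<sigma> \<psi>"
  by (auto simp: capture_free_def)

lemma capture_free_modal [simp]:
  "capture_free \<sigma> (Box a \<phi>) = capture_free \<sigma> \<phi>" "capture_free \<sigma> (Dia a \<phi>) = capture_free \<sigma> \<phi>"
  by (simp_all add: capture_free_def)

lemma capture_free_MuD:
  assumes "capture_free \<sigma> (Mu X \<phi>)"
  shows "capture_free (\<sigma>(X := Var X)) \<phi>" "Y \<in> fv \<phi> \<Longrightarrow> Y \<noteq> X \<Longrightarrow> X \<notin> fv (\<sigma> Y)"
proof -
  have *: "\<sigma> Y = Var Y \<or> insert X (bv \<phi>) \<inter> fv (\<sigma> Y) = {}" if "Y \<in> fv \<phi>" "Y \<noteq> X" for Y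
    using assms that by (simp add: capture_free_def)
  show "capture_free (\<sigma>(X := Var X)) \<phi>" using * by (fastforce simp: capture_free_def)
  show "X \<notin> fv (\<sigma> Y)" if "Y \<in> fv \<phi>" "Y \<noteq> X" using *[OF that] that by auto
qed

lemma capture_free_NuD:
  assumes "capture_free \<sigma> (Nu X \<phi>)"
  shows "capture_free (\<sigma>(X := Var X)) \<phi>" "Y \<in> fv \<phi> \<Longrightarrow> Y \<noteq> X \<Longrightarrow> X \<notin> fv (\<sigma> Y)"
proof -
  have *: "\<sigma> Y = Var Y \<or> insert X (bv \<phi>) \<inter> fv (\<sigma> Y) = {}" if "Y \<in> fv \<phi>" "Y \<noteq> X" for Y
    using assms that by (simp add: capture_free_def)
  show "capture_free (\<sigma>(X := Var X)) \<phi>" using * by (fastforce simp: capture_free_def)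
  show "X \<notin> fv (\<sigma> Y)" if "Y \<in> fv \<phi>" "Y \<noteq> X" using *[OF that] that by auto
qed

text \<open>An offending occurrence of a bound \<open>X\<close> would either come from a substituted
  formula with \<open>X\<close> free, which capture-freeness excludes, or be present in
  \<open>\<phi>\<close> already.\<close>

lemma stratified_msubst:
  assumes "stratified \<phi>" "\<And>Y. Y \<in> fv \<phi> \<Longrightarrow> stratified (\<sigma> Y)" "capture_free \<sigma> \<phi>"
  shows "stratified (msubst \<sigma> \<phi>)"
  using assms
proof (induction \<phi> arbitrary: \<sigma>)
  case (Mu X \<phi>)
  note cf = capture_free_MuD[OF Mu.prems(3)]
  have "X \<notin> nuv (msubst (\<sigma>(X := Var X)) \<phi>)"
  proof
    assume "X \<in> nuv (msubst (\<sigma>(X := Var X)) \<phi>)"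
    then obtain Y where "Y \<in> fv \<phi> \<and> X \<in> nuv ((\<sigma>(X := Var X)) Y) \<or> Y \<in> nuv \<phi> \<and> X \<in> fv ((\<sigma>(X := Var X)) Y)"
      using nuv_msubst by blast
    then show False using cf(2)[of Y] nuv_subset_fv[of "\<sigma> Y"] nuv_subset_fv[of \<phi>] Mu.prems(1)
      by (auto split: if_splits)
  qed
  then show ?case using Mu cf(1) by simp
next
  case (Nu X \<phi>)
  note cf = capture_free_NuD[OF Nu.prems(3)]
  have "X \<notin> muv (msubst (\<sigma>(X := Var X)) \<phi>)"
  proof
    assume "X \<in> muv (msubst (\<sigma>(X := Var X)) \<phi>)"
    then obtain Y where "Y \<in> fv \<phi> \<and> X \<in> muv ((\<sigma>(X := Var X)) Y) \<or> Y \<in> muv \<phi> \<and> X \<in> fv ((\<sigma>(X := Var X)) Y)"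
      using muv_msubst by blast
    then show False using cf(2)[of Y] muv_subset_fv[of "\<sigma> Y"] muv_subset_fv[of \<phi>] Nu.prems(1)
      by (auto split: if_splits)
  qed
  then show ?case using Nu cf(1) by simp
qed (auto dest: capture_free_ConjD capture_free_DisjD)

lemma mu_free_dual_msubst:
  "mu_free (dual \<phi>) \<Longrightarrow> (\<And>Y. Y \<in> fv \<phi> \<Longrightarrow> mu_free (dual (\<sigma> Y))) \<Longrightarrow>
    mu_free (dual (msubst \<sigma> \<phi>))"
  by (induction \<phi> arbitrary: \<sigma>) auto

section \<open>Stratified formulas are alternation-free\<close>

text \<open>The library function \<open>size\<close> also counts the variable indices.\<close>

primrec fml_size :: "('p, 'a) fml \<Rightarrow> nat" where
  "fml_size (Var X) = 0"
| "fml_size (Prop p) = 0"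
| "fml_size (NProp p) = 0"
| "fml_size (Conj \<phi> \<psi>) = Suc (fml_size \<phi> + fml_size \<psi>)"
| "fml_size (Disj \<phi> \<psi>) = Suc (fml_size \<phi> + fml_size \<psi>)"
| "fml_size (Box a \<phi>) = Suc (fml_size \<phi>)"
| "fml_size (Dia a \<phi>) = Suc (fml_size \<phi>)"
| "fml_size (Mu X \<phi>) = Suc (fml_size \<phi>)"
| "fml_size (Nu X \<phi>) = Suc (fml_size \<phi>)"

lemma subst_idle: "X \<notin> fv \<phi> \<Longrightarrow> subst \<phi> X \<psi> = \<phi>"
  by (induction \<phi>) auto

lemma free_for_idle: "X \<notin> fv \<phi> \<Longrightarrow> free_for \<psi> X \<phi>"
  by (induction \<phi>) auto

section \<open>Duality of the hierarchy levels\<close>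

lemma dual_subst: "dual (subst \<phi> X \<psi>) = subst (dual \<phi>) X (dual \<psi>)"
  by (induction \<phi>) auto

lemma free_for_dual: "free_for (dual \<psi>) X (dual \<phi>) = free_for \<psi> X \<phi>"
  by (induction \<phi>) auto

lemma fixpoint_free_dual: "fixpoint_free (dual \<phi>) = fixpoint_free \<phi>"
  by (induction \<phi>) auto

lemma dual_fp_closure_Mu:
  assumes "\<phi> \<in> fp_closure Mu B" "\<And>\<beta>. \<beta> \<in> B \<Longrightarrow> dual \<beta> \<in> B'"
  shows "dual \<phi> \<in> fp_closure Nu B'"
  using assms(1)
  by induction (auto simp: dual_subst free_for_dual intro: fp_closure.intros assms(2))

lemma dual_fp_closure_Nu:
  assumes "\<phi> \<in> fp_closure Nu B" "\<And>\<beta>. \<beta> \<in> B \<Longrightarrow> dual \<beta> \<in> B'"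
  shows "dual \<phi> \<in> fp_closure Mu B'"
  using assms(1)
  by induction (auto simp: dual_subst free_for_dual intro: fp_closure.intros assms(2))

lemma dual_level:
  "(\<phi> \<in> Sigma_level n \<longrightarrow> dual \<phi> \<in> Pi_level n) \<and> (\<phi> \<in> Pi_level n \<longrightarrow> dual \<phi> \<in> Sigma_level n)"
proof (induction n arbitrary: \<phi>)
  case 0
  show ?case by (simp add: fixpoint_free_dual)
next
  case (Suc n)
  show ?case
    using dual_fp_closure_Mu[of \<phi> "Sigma_level n \<union> Pi_level n" "Sigma_level n \<union> Pi_level n"]
      dual_fp_closure_Nu[of \<phi> "Sigma_level n \<union> Pi_level n" "Sigma_level n \<union> Pi_level n"] Suc
    by auto
qed

lemma mu_free_Pi_1: "mu_free \<phi> \<Longrightarrow> \<phi> \<in> Pi_level (Suc 0)"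
proof (induction \<phi>)
  case (Nu X \<phi>)
  then show ?case by (auto intro: fp_closure.fixp)
qed (auto intro: fp_closure.intros)

text \<open>Descending to a \<open>Mu\<close>-subformula meets no \<open>Mu\<close> on the way, and
  by stratification the variables of the \<open>Nu\<close> binders passed are not free in it. Hence
  it can be cut out as \<open>\<chi>\<close>, leaving the variable \<open>Z\<close>, and put back
  without capture. The size bounds support the induction that follows; \<open>\<chi>\<close> may be
  all of \<open>\<phi>\<close>.\<close>

lemma extract_Mu_subformula:
  assumes "\<not> mu_free \<phi>" "stratified \<phi>" "Z \<notin> fv \<phi>" "Z \<notin> bv \<phi>"
  shows "\<exists>\<phi>' \<chi>. \<phi> = subst \<phi>' Z \<chi> \<and> free_for \<chi> Z \<phi>' \<and> stratified \<phi>' \<and> stratified \<chi> \<and>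
    fv \<chi> \<subseteq> muv \<phi> \<and> muv \<phi>' \<subseteq> muv \<phi> \<and> fml_size \<phi>' < fml_size \<phi> \<and> fml_size \<chi> \<le> fml_size \<phi>"
  using assms
proof (induction \<phi>)
  case (Conj \<phi>1 \<phi>2)
  show ?case
  proof (cases "mu_free \<phi>1")
    case True
    with Conj obtain \<phi>' \<chi> where "\<phi>2 = subst \<phi>' Z \<chi>" "free_for \<chi> Z \<phi>'" "stratified \<phi>'"
      "stratified \<chi>" "fv \<chi> \<subseteq> muv \<phi>2" "muv \<phi>' \<subseteq> muv \<phi>2" "fml_size \<phi>' < fml_size \<phi>2" "fml_size \<chi> \<le> fml_size \<phi>2"
      by auto
    then show ?thesis using Conj.prems
      by - (rule exI[of _ "Conj \<phi>1 \<phi>'"], rule exI[of _ \<chi>], auto simp: subst_idle free_for_idle)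
  next
    case False
    with Conj obtain \<phi>' \<chi> where "\<phi>1 = subst \<phi>' Z \<chi>" "free_for \<chi> Z \<phi>'" "stratified \<phi>'"
      "stratified \<chi>" "fv \<chi> \<subseteq> muv \<phi>1" "muv \<phi>' \<subseteq> muv \<phi>1" "fml_size \<phi>' < fml_size \<phi>1" "fml_size \<chi> \<le> fml_size \<phi>1"
      by auto
    then show ?thesis using Conj.prems
      by - (rule exI[of _ "Conj \<phi>' \<phi>2"], rule exI[of _ \<chi>], auto simp: subst_idle free_for_idle)
  qed
next
  case (Disj \<phi>1 \<phi>2)
  show ?case
  proof (cases "mu_free \<phi>1")
    case True
    with Disj obtain \<phi>' \<chi> where "\<phi>2 = subst \<phi>' Z \<chi>" "free_for \<chi> Z \<phi>'" "stratified \<phi>'"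
      "stratified \<chi>" "fv \<chi> \<subseteq> muv \<phi>2" "muv \<phi>' \<subseteq> muv \<phi>2" "fml_size \<phi>' < fml_size \<phi>2" "fml_size \<chi> \<le> fml_size \<phi>2"
      by auto
    then show ?thesis using Disj.prems
      by - (rule exI[of _ "Disj \<phi>1 \<phi>'"], rule exI[of _ \<chi>], auto simp: subst_idle free_for_idle)
  next
    case False
    with Disj obtain \<phi>' \<chi> where "\<phi>1 = subst \<phi>' Z \<chi>" "free_for \<chi> Z \<phi>'" "stratified \<phi>'"
      "stratified \<chi>" "fv \<chi> \<subseteq> muv \<phi>1" "muv \<phi>' \<subseteq> muv \<phi>1" "fml_size \<phi>' < fml_size \<phi>1" "fml_size \<chi> \<le> fml_size \<phi>1"
      by auto
    then show ?thesis using Disj.prems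
      by - (rule exI[of _ "Disj \<phi>' \<phi>2"], rule exI[of _ \<chi>], auto simp: subst_idle free_for_idle)
  qed
next
  case (Box a \<phi>)
  then obtain \<phi>' \<chi> where "\<phi> = subst \<phi>' Z \<chi>" "free_for \<chi> Z \<phi>'" "stratified \<phi>'"
    "stratified \<chi>" "fv \<chi> \<subseteq> muv \<phi>" "muv \<phi>' \<subseteq> muv \<phi>" "fml_size \<phi>' < fml_size \<phi>" "fml_size \<chi> \<le> fml_size \<phi>"
    by auto
  then show ?case by - (rule exI[of _ "Box a \<phi>'"], rule exI[of _ \<chi>], auto)
next
  case (Dia a \<phi>)
  then obtain \<phi>' \<chi> where "\<phi> = subst \<phi>' Z \<chi>" "free_for \<chi> Z \<phi>'" "stratified \<phi>'"
    "stratified \<chi>" "fv \<chi> \<subseteq> muv \<phi>" "muv \<phi>' \<subseteq> muv \<phi>" "fml_size \<phi>' < fml_size \<phi>" "fml_size \<chi> \<le> fml_size \<phi>"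
    by auto
  then show ?case by - (rule exI[of _ "Dia a \<phi>'"], rule exI[of _ \<chi>], auto)
next
  case (Mu X \<phi>)
  then show ?case by - (rule exI[of _ "Var Z"], rule exI[of _ "Mu X \<phi>"], auto)
next
  case (Nu X \<phi>)
  then have Z: "Z \<noteq> X" "Z \<notin> fv \<phi>" and \<phi>: "stratified \<phi>" "X \<notin> muv \<phi>" "\<not> mu_free \<phi>" "Z \<notin> bv \<phi>"
    by auto
  obtain \<phi>' \<chi> where *: "\<phi> = subst \<phi>' Z \<chi>" "free_for \<chi> Z \<phi>'" "stratified \<phi>'"
    "stratified \<chi>" "fv \<chi> \<subseteq> muv \<phi>" "muv \<phi>' \<subseteq> muv \<phi>" "fml_size \<phi>' < fml_size \<phi>"
    "fml_size \<chi> \<le> fml_size \<phi>"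
    using Nu.IH[OF \<phi>(3,1) Z(2) \<phi>(4)] by blast
  have "X \<notin> fv \<chi>" "X \<notin> muv \<phi>'" using * \<phi>(2) by blast+
  moreover have "fv \<chi> \<subseteq> muv \<phi> - {X}" "muv \<phi>' - {X} \<subseteq> muv \<phi> - {X}"
    using * \<phi>(2) by blast+
  moreover have "Nu X \<phi> = subst (Nu X \<phi>') Z \<chi>" using *(1) Z by simp
  ultimately show ?case using *(2-4,7,8) Z
    by - (rule exI[of _ "Nu X \<phi>'"], rule exI[of _ \<chi>], simp)
qed auto

text \<open>Induction on size, where only \<open>Nu\<close> is not a closure rule of the level. If
  the body is free of \<open>Mu\<close>, the formula is already in \<open>Pi_level 1\<close>;
  otherwise a \<open>Mu\<close>-subformula is cut out, and the two smaller pieces are recombined by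
  the substitution rule.\<close>

lemma stratified_Sigma_2:
  assumes "stratified \<phi>"
  shows "\<phi> \<in> Sigma_level (Suc (Suc 0))"
  using assms
proof (induction "fml_size \<phi>" arbitrary: \<phi> rule: less_induct)
  case less
  let ?B = "Sigma_level (Suc 0) \<union> Pi_level (Suc 0) :: ('a, 'b) fml set"
  have base: "\<psi> \<in> fp_closure Mu ?B" if "mu_free \<psi>" for \<psi> :: "('a, 'b) fml"
    using mu_free_Pi_1[OF that] by (intro fp_closure.base) auto
  have leaf: "Var X \<in> fp_closure Mu ?B" "Prop p \<in> fp_closure Mu ?B" "NProp p \<in> fp_closure Mu ?B" for X p
    by (rule base; simp)+
  have IH: "\<psi> \<in> fp_closure Mu ?B" if "fml_size \<psi> < fml_size \<phi>" "stratified \<psi>" for \<psi>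
    using less.hyps that by simp
  have "\<phi> \<in> fp_closure Mu ?B"
  proof (cases \<phi>)
    case (Nu X \<psi>)
    show ?thesis
    proof (cases "mu_free \<psi>")
      case True
      then show ?thesis using Nu base by simp
    next
      case False
      obtain Z where Z: "Z \<notin> insert X (fv \<psi> \<union> bv \<psi>)"
        using ex_new_if_finite[of "insert X (fv \<psi> \<union> bv \<psi>)"] finite_fv finite_bv by auto
      with False less.prems Nu extract_Mu_subformula[of \<psi> Z] obtain \<psi>' \<chi> where *:
        "\<psi> = subst \<psi>' Z \<chi>" "free_for \<chi> Z \<psi>'" "stratified \<psi>'" "stratified \<chi>"
        "fv \<chi> \<subseteq> muv \<psi>" "muv \<psi>' \<subseteq> muv \<psi>" "fml_size \<psi>' < fml_size \<psi>" "fml_size \<chi> \<le> fml_size \<psi>"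
        by auto
      have "subst (Nu X \<psi>') Z \<chi> \<in> fp_closure Mu ?B"
      proof (rule fp_closure.subst)
        show "Nu X \<psi>' \<in> fp_closure Mu ?B" by (rule IH) (use * less.prems Nu in auto)
        show "\<chi> \<in> fp_closure Mu ?B" by (rule IH) (use * less.prems Nu in auto)
        show "free_for \<chi> Z (Nu X \<psi>')" using * less.prems Nu by auto
      qed
      then show ?thesis using Z * Nu by auto
    qed
  qed (use less.prems in \<open>auto simp del: Sigma_level.simps Pi_level.simps
        intro!: leaf fp_closure.conj fp_closure.disj fp_closure.box fp_closure.dia
          fp_closure.fixp intro: IH\<close>)
  then show ?case by simp
qed

text \<open>Stratification is self-dual, so the \<Pi>-half is the \<Sigma>-half for the dual
  formula.\<close>

lemma stratified_alternation_free:
  assumes "stratified \<phi>"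
  shows "alternation_free \<phi>"
proof -
  have "dual (dual \<phi>) \<in> Pi_level (Suc (Suc 0))"
    using stratified_Sigma_2[of "dual \<phi>"] dual_level assms stratified_dual by blast
  then show ?thesis
    using stratified_Sigma_2[OF assms]
    by (simp add: alternation_free_def Delta_level_def numeral_2_eq_2 del: Sigma_level.simps Pi_level.simps)
qed

section \<open>Semantics\<close>

lemma sem_cong:
  "(\<And>X. X \<in> fv \<phi> \<Longrightarrow> \<rho> X \<inter> verts G = \<rho>' X \<inter> verts G) \<Longrightarrow> sem G \<phi> \<rho> = sem G \<phi> \<rho>'"
proof (induction \<phi> arbitrary: \<rho> \<rho>')
  case (Conj \<phi> \<psi>)
  show ?case using Conj.IH[of \<rho> \<rho>'] Conj.prems by simp
next
  case (Disj \<phi> \<psi>)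
  show ?case using Disj.IH[of \<rho> \<rho>'] Disj.prems by simp
next
  case (Box a \<phi>)
  show ?case using Box.IH[of \<rho> \<rho>'] Box.prems by simp
next
  case (Dia a \<phi>)
  show ?case using Dia.IH[of \<rho> \<rho>'] Dia.prems by simp
next
  case (Mu X \<phi>)
  have "sem G \<phi> (\<rho>(X := S)) = sem G \<phi> (\<rho>'(X := S))" for S
    by (rule Mu.IH) (use Mu.prems in auto)
  then show ?case by simp
next
  case (Nu X \<phi>)
  have "sem G \<phi> (\<rho>(X := S)) = sem G \<phi> (\<rho>'(X := S))" for S
    by (rule Nu.IH) (use Nu.prems in auto)
  then show ?case by simp
qed auto

lemma sem_Int_verts: "sem G \<phi> \<rho> \<inter> verts G = sem G \<phi> \<rho>"
  using sem_subset_verts[of G \<phi> \<rho>] by blast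

lemma sem_msubst:
  "capture_free \<sigma> \<phi> \<Longrightarrow> sem G (msubst \<sigma> \<phi>) \<rho> = sem G \<phi> (\<lambda>Y. sem G (\<sigma> Y) \<rho>)"
proof (induction \<phi> arbitrary: \<sigma> \<rho>)
  case (Var X)
  show ?case by (simp add: sem_Int_verts)
next
  case (Mu X \<phi>)
  note cf = capture_free_MuD[OF Mu.prems]
  have "sem G (msubst (\<sigma>(X := Var X)) \<phi>) (\<rho>(X := S)) =
      sem G \<phi> ((\<lambda>Y. sem G (\<sigma> Y) \<rho>)(X := S))" for S
    unfolding Mu.IH[OF cf(1)]
  proof (rule sem_cong)
    fix Y assume "Y \<in> fv \<phi>"
    then have "sem G (\<sigma> Y) (\<rho>(X := S)) = sem G (\<sigma> Y) \<rho>" if "Y \<noteq> X"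
      using cf(2) that by (intro sem_cong) auto
    then show "sem G ((\<sigma>(X := Var X)) Y) (\<rho>(X := S)) \<inter> verts G =
        ((\<lambda>Y. sem G (\<sigma> Y) \<rho>)(X := S)) Y \<inter> verts G"
      by auto
  qed
  then show ?case by simp
next
  case (Nu X \<phi>)
  note cf = capture_free_NuD[OF Nu.prems]
  have "sem G (msubst (\<sigma>(X := Var X)) \<phi>) (\<rho>(X := S)) =
      sem G \<phi> ((\<lambda>Y. sem G (\<sigma> Y) \<rho>)(X := S))" for S
    unfolding Nu.IH[OF cf(1)]
  proof (rule sem_cong)
    fix Y assume "Y \<in> fv \<phi>"
    then have "sem G (\<sigma> Y) (\<rho>(X := S)) = sem G (\<sigma> Y) \<rho>" if "Y \<noteq> X"
      using cf(2) that by (intro sem_cong) auto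
    then show "sem G ((\<sigma>(X := Var X)) Y) (\<rho>(X := S)) \<inter> verts G =
        ((\<lambda>Y. sem G (\<sigma> Y) \<rho>)(X := S)) Y \<inter> verts G"
      by auto
  qed
  then show ?case by simp
qed (auto dest: capture_free_ConjD capture_free_DisjD)

text \<open>Complements are relative to \<open>V\<close>, whereas \<open>lfp\<close> and
  \<open>gfp\<close> range over all sets of the type. The assumption \<open>cong\<close> makes
  \<open>f\<close> blind to elements outside \<open>V\<close>, so that a double complement does no
  harm.\<close>

lemma gfp_complement:
  fixes f :: "'v set \<Rightarrow> 'v set"
  assumes "mono f" and cong: "\<And>S T. S \<inter> V = T \<inter> V \<Longrightarrow> f S = f T" and "\<And>S. f S \<subseteq> V"
  shows "gfp (\<lambda>S. V - f (V - S)) = V - lfp f"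
proof (rule antisym)
  let ?g = "\<lambda>S. V - f (V - S)"
  have "mono ?g" by (intro monoI Diff_mono order_refl monoD[OF assms(1)])
  then have g: "gfp ?g = V - f (V - gfp ?g)" by (rule gfp_unfold)
  have "V - gfp ?g = f (V - gfp ?g)" by (subst g) (simp add: double_diff assms(3))
  then have "f (V - gfp ?g) \<subseteq> V - gfp ?g" by simp
  then have "lfp f \<subseteq> V - gfp ?g" by (rule lfp_lowerbound)
  moreover have "gfp ?g \<subseteq> V" by (subst g) (rule Diff_subset)
  ultimately show "gfp ?g \<subseteq> V - lfp f" by blast
  have "f (V - (V - lfp f)) = f (lfp f)" by (rule cong) auto
  then have "V - lfp f \<subseteq> ?g (V - lfp f)" using lfp_unfold[OF assms(1)] by simp
  then show "V - lfp f \<subseteq> gfp ?g" by (rule gfp_upperbound)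
qed

text \<open>Follows from \<open>gfp_complement\<close> for the conjugate \<open>?g\<close>, whose
  own conjugate is \<open>f\<close> again.\<close>

lemma lfp_complement:
  fixes f :: "'v set \<Rightarrow> 'v set"
  assumes "mono f" and cong: "\<And>S T. S \<inter> V = T \<inter> V \<Longrightarrow> f S = f T" and "\<And>S. f S \<subseteq> V"
  shows "lfp (\<lambda>S. V - f (V - S)) = V - gfp f"
proof -
  let ?g = "\<lambda>S. V - f (V - S)"
  have "mono ?g" by (intro monoI Diff_mono order_refl monoD[OF assms(1)])
  have "gfp (\<lambda>S. V - ?g (V - S)) = V - lfp ?g"
  proof (rule gfp_complement)
    show "mono ?g" by fact
    show "?g S = ?g T" if "S \<inter> V = T \<inter> V" for S T
    proof -
      have "f (V - S) = f (V - T)" by (rule cong) (use that in blast)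
      then show ?thesis by simp
    qed
  qed blast
  moreover have "V - ?g (V - S) = f S" for S
  proof -
    have "f (V - (V - S)) = f S" by (rule cong) blast
    then show ?thesis using assms(3)[of S] by auto
  qed
  moreover have "lfp ?g \<subseteq> V" by (rule lfp_lowerbound) blast
  ultimately show ?thesis by (simp add: double_diff)
qed

text \<open>The assumption \<open>is_graph G\<close> enters at the modalities: a successor outside a
  denotation lies in its relative complement because edges stay within
  \<open>verts G\<close>.\<close>

lemma sem_dual:
  assumes "is_graph G"
  shows "sem G (dual \<phi>) \<rho> = verts G - sem G \<phi> (\<lambda>X. verts G - \<rho> X)"
proof (induction \<phi> arbitrary: \<rho>)
  case (Mu X \<phi>)
  let ?f = "\<lambda>S. sem G \<phi> ((\<lambda>X. verts G - \<rho> X)(X := S))"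
  have dual: "sem G (dual \<phi>) (\<rho>(X := S)) = verts G - ?f (verts G - S)" for S
    unfolding Mu.IH by (rule arg_cong[where f = "\<lambda>\<rho>. verts G - sem G \<phi> \<rho>"]) (auto simp: fun_eq_iff)
  have "?f S = ?f T" if "S \<inter> verts G = T \<inter> verts G" for S T
    by (rule sem_cong) (use that in auto)
  from gfp_complement[OF mono_sem this sem_subset_verts] dual
  show ?case by simp
next
  case (Nu X \<phi>)
  let ?f = "\<lambda>S. sem G \<phi> ((\<lambda>X. verts G - \<rho> X)(X := S))"
  have dual: "sem G (dual \<phi>) (\<rho>(X := S)) = verts G - ?f (verts G - S)" for S
    unfolding Nu.IH by (rule arg_cong[where f = "\<lambda>\<rho>. verts G - sem G \<phi> \<rho>"]) (auto simp: fun_eq_iff)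
  have "?f S = ?f T" if "S \<inter> verts G = T \<inter> verts G" for S T
    by (rule sem_cong) (use that in auto)
  from lfp_complement[OF mono_sem this sem_subset_verts] dual
  show ?case by simp
next
  case (Box a \<phi>)
  show ?case by (use assms in \<open>auto simp: Box.IH is_graph_def\<close>)
next
  case (Dia a \<phi>)
  show ?case by (use assms in \<open>auto simp: Dia.IH is_graph_def\<close>)
qed auto

section \<open>Nu-free systems of equations\<close>

lemma capture_free_bv_empty: "bv \<phi> = {} \<Longrightarrow> capture_free \<sigma> \<phi>"
  by (simp add: capture_free_def)

lemma sem_fun_upd_Var:
  "sem G \<phi> (\<lambda>Y. sem G ((Var(X := \<chi>)) Y) \<rho>) = sem G \<phi> (\<rho>(X := sem G \<chi> \<rho>))"
  by (rule sem_cong) auto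

text \<open>Bekic's principle: a simultaneous system of pure \<mu>-equations is solved by
  eliminating one unknown at a time. The formulas \<open>e\<close> are chosen before the graph and
  the valuation. Leastness is stated against all closed families, which avoids fixpoints on
  tuples.\<close>

lemma least_solution:
  fixes g :: "nat \<Rightarrow> ('p, 'a) fml"
  assumes "finite Z"
    and "\<And>z. z \<in> Z \<Longrightarrow> mu_free (dual (g z)) \<and> fv (g z) \<subseteq> P \<union> Z \<and> bv (g z) = {}"
    and "Z \<inter> P = {}"
  shows "\<exists>e. \<forall>z\<in>Z. mu_free (dual (e z)) \<and> fv (e z) \<subseteq> P \<and> bv (e z) \<subseteq> Z \<and>
    (\<forall>(G :: ('v, 'p, 'a) graph) \<rho>.
      sem G (g z) (override_on \<rho> (\<lambda>z. sem G (e z) \<rho>) Z) \<subseteq> sem G (e z) \<rho> \<and>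
      (\<forall>S. (\<forall>z\<in>Z. sem G (g z) (override_on \<rho> S Z) \<subseteq> S z) \<longrightarrow> sem G (e z) \<rho> \<subseteq> S z))"
  using assms
proof (induction Z arbitrary: P rule: finite_induct)
  case empty
  show ?case by simp
next
  case (insert z0 Z)
  \<comment> \<open>The other unknowns are solved first, with \<open>z0\<close> as an additional
    parameter.\<close>
  have "\<exists>e. \<forall>z\<in>Z. mu_free (dual (e z)) \<and> fv (e z) \<subseteq> insert z0 P \<and> bv (e z) \<subseteq> Z \<and>
    (\<forall>(G :: ('v, 'p, 'a) graph) \<rho>.
      sem G (g z) (override_on \<rho> (\<lambda>z. sem G (e z) \<rho>) Z) \<subseteq> sem G (e z) \<rho> \<and>
      (\<forall>S. (\<forall>z\<in>Z. sem G (g z) (override_on \<rho> S Z) \<subseteq> S z) \<longrightarrow> sem G (e z) \<rho> \<subseteq> S z))"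
    by (rule insert.IH) (use insert.prems insert.hyps in auto)
  then obtain e' where e': "\<And>z. z \<in> Z \<Longrightarrow> mu_free (dual (e' z))"
      "\<And>z. z \<in> Z \<Longrightarrow> fv (e' z) \<subseteq> insert z0 P" "\<And>z. z \<in> Z \<Longrightarrow> bv (e' z) \<subseteq> Z"
    and closed: "\<And>(G :: ('v, 'p, 'a) graph) \<rho> z. z \<in> Z \<Longrightarrow>
      sem G (g z) (override_on \<rho> (\<lambda>z. sem G (e' z) \<rho>) Z) \<subseteq> sem G (e' z) \<rho>"
    and least: "\<And>(G :: ('v, 'p, 'a) graph) \<rho> S z. (\<And>z. z \<in> Z \<Longrightarrow>
      sem G (g z) (override_on \<rho> S Z) \<subseteq> S z) \<Longrightarrow> z \<in> Z \<Longrightarrow> sem G (e' z) \<rho> \<subseteq> S z"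
    by metis
  \<comment> \<open>\<open>g0\<close> is the equation of \<open>z0\<close> after elimination of the
    others. It needs one more \<open>Mu\<close>, and its solution is then substituted back into
    \<open>e'\<close>.\<close>
  define g0 where "g0 = msubst (override_on Var e' Z) (g z0)"
  define e where "e z = (if z = z0 then Mu z0 g0 else msubst (Var(z0 := Mu z0 g0)) (e' z))" for z
  have z0: "z0 \<notin> Z" "z0 \<notin> P" using insert by auto
  have g_z0: "mu_free (dual (g z0))" "fv (g z0) \<subseteq> insert z0 (P \<union> Z)" "bv (g z0) = {}"
    using insert.prems(1)[of z0] by auto
  have g0: "mu_free (dual g0)"
    unfolding g0_def by (rule mu_free_dual_msubst) (use g_z0 e' in \<open>auto simp: override_on_def\<close>)
  have fv_g0: "fv g0 \<subseteq> insert z0 P"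
    using fv_msubst[of "override_on Var e' Z" "g z0"] g_z0(2) e'(2)
    unfolding g0_def override_on_def by (fastforce split: if_splits)
  have bv_g0: "bv g0 \<subseteq> Z"
    using bv_msubst[of "override_on Var e' Z" "g z0"] g_z0(3) e'(3)
    unfolding g0_def override_on_def by (fastforce split: if_splits)
  have sem_g0: "sem G g0 \<rho> = sem G (g z0) (override_on \<rho> (\<lambda>z. sem G (e' z) \<rho>) Z)"
    for G :: "('v, 'p, 'a) graph" and \<rho>
    unfolding g0_def sem_msubst[OF capture_free_bv_empty[OF g_z0(3)]]
    by (rule sem_cong) (auto simp: override_on_def)
  have sem_e: "sem G (e z) \<rho> = sem G (e' z) (\<rho>(z0 := sem G (e z0) \<rho>))" if "z \<in> Z"
    for G :: "('v, 'p, 'a) graph" and \<rho> z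
  proof -
    \<comment> \<open>The free variables of \<open>Mu z0 g0\<close> lie in \<open>P\<close>, the
      bound variables of \<open>e' z\<close> in \<open>Z\<close>.\<close>
    have "capture_free (Var(z0 := Mu z0 g0)) (e' z)"
      using e'(3)[OF that] fv_g0 insert.prems(2) by (auto simp: capture_free_def)
    then have "sem G (e z) \<rho> = sem G (e' z) (\<lambda>Y. sem G ((Var(z0 := Mu z0 g0)) Y) \<rho>)"
      using that z0 by (auto simp: e_def sem_msubst simp del: fun_upd_apply)
    then show ?thesis unfolding sem_fun_upd_Var by (simp add: e_def)
  qed
  have override: "override_on \<rho> S (insert z0 Z) = override_on (\<rho>(z0 := S z0)) S Z"
    for \<rho> S :: "nat \<Rightarrow> 'v set"
    using z0 by (auto simp: override_on_def fun_eq_iff)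
  have override_e: "override_on \<rho> (\<lambda>z. sem G (e z) \<rho>) (insert z0 Z) = (let \<rho>' = \<rho>(z0 := sem G (e z0) \<rho>)
      in override_on \<rho>' (\<lambda>z. sem G (e' z) \<rho>') Z)" for G :: "('v, 'p, 'a) graph" and \<rho>
    using z0 sem_e by (auto simp: override_on_def fun_eq_iff Let_def)
  have syntactic: "mu_free (dual (e z)) \<and> fv (e z) \<subseteq> P \<and> bv (e z) \<subseteq> insert z0 Z" if "z \<in> insert z0 Z" for z
  proof (cases "z = z0")
    case True
    then show ?thesis using g0 fv_g0 bv_g0 by (auto simp: e_def)
  next
    case False
    then have z: "z \<in> Z" using that by simp
    have "mu_free (dual (msubst (Var(z0 := Mu z0 g0)) (e' z)))"
      by (rule mu_free_dual_msubst) (use e'(1)[OF z] g0 in auto)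
    moreover have "fv (msubst (Var(z0 := Mu z0 g0)) (e' z)) \<subseteq> P"
      using fv_msubst[of "Var(z0 := Mu z0 g0)" "e' z"] e'(2)[OF z] fv_g0
      by (fastforce split: if_splits)
    moreover have "bv (msubst (Var(z0 := Mu z0 g0)) (e' z)) \<subseteq> insert z0 Z"
      using bv_msubst[of "Var(z0 := Mu z0 g0)" "e' z"] e'(3)[OF z] bv_g0
      by (fastforce split: if_splits)
    ultimately show ?thesis using False by (simp add: e_def)
  qed
  have closed_e: "sem G (g z) (override_on \<rho> (\<lambda>z. sem G (e z) \<rho>) (insert z0 Z)) \<subseteq> sem G (e z) \<rho>"
    if "z \<in> insert z0 Z" for G :: "('v, 'p, 'a) graph" and \<rho> z
  proof (cases "z = z0")
    case True
    have "sem G g0 (\<rho>(z0 := sem G (e z0) \<rho>)) = sem G (e z0) \<rho>"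
      using lfp_unfold[OF mono_sem[of G g0 \<rho> z0]] by (simp add: e_def)
    then show ?thesis using True by (simp add: override_e Let_def sem_g0)
  next
    case False
    then show ?thesis using that closed[of z] by (simp add: override_e Let_def sem_e)
  qed
  have least_e: "sem G (e z) \<rho> \<subseteq> S z"
    if S: "\<forall>z\<in>insert z0 Z. sem G (g z) (override_on \<rho> S (insert z0 Z)) \<subseteq> S z" and z: "z \<in> insert z0 Z"
    for G :: "('v, 'p, 'a) graph" and \<rho> z S
  proof -
    \<comment> \<open>Once \<open>z0\<close> is set to \<open>S z0\<close>, leastness of
      \<open>e'\<close> puts the other components below \<open>S\<close>; this makes
      \<open>S z0\<close> a pre-fixed point of \<open>g0\<close>.\<close>
    have le: "sem G (e' z) (\<rho>(z0 := S z0)) \<subseteq> S z" if "z \<in> Z" for z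
      by (rule least[OF _ that], rule S[unfolded override, rule_format]) simp
    have "sem G g0 (\<rho>(z0 := S z0)) \<subseteq> sem G (g z0) (override_on (\<rho>(z0 := S z0)) S Z)"
      unfolding sem_g0 by (rule sem_mono) (use le in \<open>auto simp: override_on_def\<close>)
    then have "sem G g0 (\<rho>(z0 := S z0)) \<subseteq> S z0" using S by (auto simp: override)
    then have e_z0: "sem G (e z0) \<rho> \<subseteq> S z0" by (simp add: e_def lfp_lowerbound)
    show ?thesis
    proof (cases "z = z0")
      case False
      then have "z \<in> Z" using z by simp
      have "sem G (e z) \<rho> \<subseteq> sem G (e' z) (\<rho>(z0 := S z0))"
        unfolding sem_e[OF \<open>z \<in> Z\<close>] by (rule sem_mono) (use e_z0 in auto)
      then show ?thesis using le[OF \<open>z \<in> Z\<close>] by blast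
    qed (use e_z0 in simp)
  qed
  show ?case
  proof (intro exI[of _ e] ballI conjI allI impI)
    fix z assume z: "z \<in> insert z0 Z"
    show "mu_free (dual (e z))" "fv (e z) \<subseteq> P" "bv (e z) \<subseteq> insert z0 Z"
      using syntactic[OF z] by auto
    fix G :: "('v, 'p, 'a) graph" and \<rho>
    show "sem G (g z) (override_on \<rho> (\<lambda>z. sem G (e z) \<rho>) (insert z0 Z)) \<subseteq> sem G (e z) \<rho>"
      by (rule closed_e[OF z])
    fix S assume "\<forall>z\<in>insert z0 Z. sem G (g z) (override_on \<rho> S (insert z0 Z)) \<subseteq> S z"
    then show "sem G (e z) \<rho> \<subseteq> S z" using z by (rule least_e)
  qed
qed

section \<open>Guarded systems\<close>

text \<open>Right-hand sides of systems of modal equations.  The states (the natural numbers below a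
  modality) occur only guarded, whereas a parameter (an argument of \<open>RVar\<close>) occurs only unguarded.\<close>

datatype ('p, 'a) rhs =
    RVar nat
  | RProp 'p
  | RNProp 'p
  | RConj "('p, 'a) rhs" "('p, 'a) rhs"
  | RDisj "('p, 'a) rhs" "('p, 'a) rhs"
  | RBox 'a nat
  | RDia 'a nat

primrec states :: "('p, 'a) rhs \<Rightarrow> nat set" where
  "states (RVar X) = {}"
| "states (RProp p) = {}"
| "states (RNProp p) = {}"
| "states (RConj r s) = states r \<union> states s"
| "states (RDisj r s) = states r \<union> states s"
| "states (RBox a q) = {q}"
| "states (RDia a q) = {q}"

primrec params :: "('p, 'a) rhs \<Rightarrow> nat set" where
  "params (RVar X) = {X}"
| "params (RProp p) = {}"
| "params (RNProp p) = {}"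
| "params (RConj r s) = params r \<union> params s"
| "params (RDisj r s) = params r \<union> params s"
| "params (RBox a q) = {}"
| "params (RDia a q) = {}"

primrec rsem :: "('v, 'p, 'a) graph \<Rightarrow> ('p, 'a) rhs \<Rightarrow> (nat \<Rightarrow> 'v set) \<Rightarrow> (nat \<Rightarrow> 'v set) \<Rightarrow> 'v set" where
  "rsem G (RVar X) \<rho> S = \<rho> X \<inter> verts G"
| "rsem G (RProp p) \<rho> S = {v \<in> verts G. p \<in> label G v}"
| "rsem G (RNProp p) \<rho> S = {v \<in> verts G. p \<notin> label G v}"
| "rsem G (RConj r s) \<rho> S = rsem G r \<rho> S \<inter> rsem G s \<rho> S"
| "rsem G (RDisj r s) \<rho> S = rsem G r \<rho> S \<union> rsem G s \<rho> S"
| "rsem G (RBox a q) \<rho> S = {v \<in> verts G. \<forall>w. (v, w) \<in> edges G a \<longrightarrow> w \<in> S q}"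
| "rsem G (RDia a q) \<rho> S = {v \<in> verts G. \<exists>w. (v, w) \<in> edges G a \<and> w \<in> S q}"

primrec fml_of :: "(nat \<Rightarrow> ('p, 'a) fml) \<Rightarrow> ('p, 'a) rhs \<Rightarrow> ('p, 'a) fml" where
  "fml_of h (RVar X) = Var X"
| "fml_of h (RProp p) = Prop p"
| "fml_of h (RNProp p) = NProp p"
| "fml_of h (RConj r s) = Conj (fml_of h r) (fml_of h s)"
| "fml_of h (RDisj r s) = Disj (fml_of h r) (fml_of h s)"
| "fml_of h (RBox a q) = Box a (h q)"
| "fml_of h (RDia a q) = Dia a (h q)"

primrec rdual :: "('p, 'a) rhs \<Rightarrow> ('p, 'a) rhs" where
  "rdual (RVar X) = RVar X"
| "rdual (RProp p) = RNProp p"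
| "rdual (RNProp p) = RProp p"
| "rdual (RConj r s) = RDisj (rdual r) (rdual s)"
| "rdual (RDisj r s) = RConj (rdual r) (rdual s)"
| "rdual (RBox a q) = RDia a q"
| "rdual (RDia a q) = RBox a q"

primrec rsubst :: "('p, 'a) rhs \<Rightarrow> nat \<Rightarrow> ('p, 'a) rhs \<Rightarrow> ('p, 'a) rhs" where
  "rsubst (RVar Y) X t = (if Y = X then t else RVar Y)"
| "rsubst (RProp p) X t = RProp p"
| "rsubst (RNProp p) X t = RNProp p"
| "rsubst (RConj r s) X t = RConj (rsubst r X t) (rsubst s X t)"
| "rsubst (RDisj r s) X t = RDisj (rsubst r X t) (rsubst s X t)"
| "rsubst (RBox a q) X t = RBox a q"
| "rsubst (RDia a q) X t = RDia a q"

text \<open>There is no constant for falsity in the syntax; \<open>undefined\<close> is just some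
  proposition.\<close>

definition rfalse :: "('p, 'a) rhs" where
  "rfalse = RConj (RProp undefined) (RNProp undefined)"

section \<open>Locality, substitution and duality of right-hand sides\<close>

lemma rsem_subset_verts: "rsem G r \<rho> S \<subseteq> verts G"
  by (induction r) auto

text \<open>Parameters are unguarded and read only at \<open>v\<close>, states are guarded and read
  only at successors of \<open>v\<close>, and both occur positively. This pointwise form drives the
  induction along the acyclic part of the graph.\<close>

lemma rsem_local:
  "v \<in> rsem G r \<rho> S \<Longrightarrow> (\<And>X. X \<in> params r \<Longrightarrow> v \<in> \<rho> X \<Longrightarrow> v \<in> \<rho>' X) \<Longrightarrow>
    (\<And>q a w. q \<in> states r \<Longrightarrow> (v, w) \<in> edges G a \<Longrightarrow> w \<in> S q \<Longrightarrow> w \<in> S' q) \<Longrightarrow>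
    v \<in> rsem G r \<rho>' S'"
  by (induction r) auto

lemma rsem_mono:
  "(\<And>X. X \<in> params r \<Longrightarrow> \<rho> X \<subseteq> \<rho>' X) \<Longrightarrow> (\<And>q. q \<in> states r \<Longrightarrow> S q \<subseteq> S' q) \<Longrightarrow>
    rsem G r \<rho> S \<subseteq> rsem G r \<rho>' S'"
  by (blast intro: rsem_local)

lemma rsem_cong:
  "(\<And>X. X \<in> params r \<Longrightarrow> \<rho> X \<inter> verts G = \<rho>' X \<inter> verts G) \<Longrightarrow>
    (\<And>q. q \<in> states r \<Longrightarrow> S q = S' q) \<Longrightarrow> rsem G r \<rho> S = rsem G r \<rho>' S'"
  by (induction r) auto

lemma rsem_rsubst: "rsem G (rsubst r X t) \<rho> S = rsem G r (\<rho>(X := rsem G t \<rho> S)) S"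
  using rsem_subset_verts[of G t \<rho> S] by (induction r) auto

lemma rsem_rfalse [simp]: "rsem G rfalse \<rho> S = {}"
  by (auto simp: rfalse_def)

lemma rsem_rdual:
  assumes "is_graph G"
  shows "rsem G (rdual r) \<rho> S = verts G - rsem G r (\<lambda>X. verts G - \<rho> X) (\<lambda>q. verts G - S q)"
  using assms by (induction r) (auto simp: is_graph_def)

text \<open>At a single vertex, the right-hand side is a monotone Boolean function of the unguarded
  parameter, whose least fixpoint is its value at \<open>False\<close>.\<close>

lemma rsem_rsubst_rfalse:
  assumes "A = rsem G (rsubst r X rfalse) \<rho> S"
  shows "rsem G r (\<rho>(X := A)) S = A"
proof
  show "rsem G r (\<rho>(X := A)) S \<subseteq> A"
  proof
    fix v assume v: "v \<in> rsem G r (\<rho>(X := A)) S"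
    show "v \<in> A"
    proof (rule ccontr)
      assume "v \<notin> A"
      \<comment> \<open>At \<open>v\<close> the parameter \<open>X\<close> is false both for
        \<open>A\<close> and for the empty set, so locality permits the exchange.\<close>
      then have "v \<in> rsem G r (\<rho>(X := {})) S"
        by (intro rsem_local[OF v]) (auto split: if_splits)
      then show False using \<open>v \<notin> A\<close> assms by (simp add: rsem_rsubst)
    qed
  qed
  show "A \<subseteq> rsem G r (\<rho>(X := A)) S"
    unfolding assms by (subst rsem_rsubst) (rule rsem_mono; simp)
qed

lemma sem_fml_of: "sem G (fml_of h r) \<rho> = rsem G r \<rho> (\<lambda>q. sem G (h q) \<rho>)"
  by (induction r) auto

lemma fv_fml_of: "fv (fml_of h r) = params r \<union> (\<Union>q\<in>states r. fv (h q))"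
  by (induction r) auto

lemma bv_fml_of: "bv (fml_of h r) = (\<Union>q\<in>states r. bv (h q))"
  by (induction r) auto

lemma stratified_fml_of: "stratified (fml_of h r) \<longleftrightarrow> (\<forall>q\<in>states r. stratified (h q))"
  by (induction r) auto

lemma mu_free_dual_fml_of: "mu_free (dual (fml_of h r)) \<longleftrightarrow> (\<forall>q\<in>states r. mu_free (dual (h q)))"
  by (induction r) auto

lemma states_rdual [simp]: "states (rdual r) = states r"
  by (induction r) auto

lemma params_rdual [simp]: "params (rdual r) = params r"
  by (induction r) auto

lemma states_rfalse [simp]: "states rfalse = {}"
  by (simp add: rfalse_def)

lemma params_rfalse [simp]: "params rfalse = {}"
  by (simp add: rfalse_def)

lemma states_rsubst: "states (rsubst r X t) \<subseteq> states r \<union> states t"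
  by (induction r) auto

lemma params_rsubst: "params (rsubst r X t) \<subseteq> params r - {X} \<union> params t"
  by (induction r) auto

section \<open>Convergence of the stages\<close>

text \<open>The semantic content of \<open>Mu X \<phi>\<close> in one graph under one valuation. The
  family \<open>hs A\<close> is some solution of the equations at \<open>X = A\<close>, monotone in
  \<open>A\<close>; it is not assumed to be least or greatest.\<close>

locale system_fixpoint =
  fixes G :: "('v, 'p, 'a) graph" and F :: "'v set" and \<rho> :: "nat \<Rightarrow> 'v set" and X :: nat
    and Q :: "nat set" and R :: "nat \<Rightarrow> ('p, 'a) rhs" and r :: "('p, 'a) rhs"
    and hs :: "'v set \<Rightarrow> nat \<Rightarrow> 'v set" and L :: "'v set"
  assumes F: "finite (verts G)" "feedback_vertex_set G F"
    and Q: "finite Q" "states r \<subseteq> Q" "\<And>q. q \<in> Q \<Longrightarrow> states (R q) \<subseteq> Q"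
    and hs: "\<And>A q. q \<in> Q \<Longrightarrow> hs A q = rsem G (R q) (\<rho>(X := A)) (hs A)"
    and mono_hs: "\<And>A B q. A \<subseteq> B \<Longrightarrow> hs A q \<subseteq> hs B q"
    and L: "L = lfp (\<lambda>A. rsem G r (\<rho>(X := A)) (hs A))"
begin

text \<open>\<open>out S\<close> is the value that the family \<open>S\<close> induces for
  \<open>X\<close>: the least solution of the output equation with the states held at
  \<open>S\<close>. In \<open>step\<close>, this value is fed back into the equations of the
  states.\<close>

abbreviation "out S \<equiv> rsem G (rsubst r X rfalse) \<rho> S"

abbreviation "step S q \<equiv> rsem G (rsubst (R q) X (rsubst r X rfalse)) \<rho> S"

lemma step_eq: "step S q = rsem G (R q) (\<rho>(X := out S)) S"
  by (rule rsem_rsubst)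

lemma out_eq: "rsem G r (\<rho>(X := out S)) S = out S"
  by (rule rsem_rsubst_rfalse) simp

lemma out_mono: "(\<And>q. q \<in> Q \<Longrightarrow> S q \<subseteq> S' q) \<Longrightarrow> out S \<subseteq> out S'"
  using states_rsubst[of r X rfalse] Q(2) by (intro rsem_mono) auto

lemma L_eq: "L = rsem G r (\<rho>(X := L)) (hs L)"
proof -
  have "mono (\<lambda>A. rsem G r (\<rho>(X := A)) (hs A))"
    by (intro monoI rsem_mono) (use mono_hs in auto)
  then show ?thesis unfolding L by (rule lfp_unfold)
qed

lemma L_lowerbound: "rsem G r (\<rho>(X := A)) (hs A) \<subseteq> A \<Longrightarrow> L \<subseteq> A"
  unfolding L by (rule lfp_lowerbound)

text \<open>By monotonicity \<open>out (hs L)\<close> is below \<open>L\<close>, hence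
  \<open>hs\<close> of it is below \<open>hs L\<close>. With \<open>out_eq\<close> this makes it a
  pre-fixed point of the operator defining \<open>L\<close>.\<close>

lemma out_hs_L: "out (hs L) = L"
proof
  show "out (hs L) \<subseteq> L"
    unfolding rsem_rsubst by (subst (2) L_eq) (rule rsem_mono; simp)
  show "L \<subseteq> out (hs L)"
  proof (rule L_lowerbound)
    have "rsem G r (\<rho>(X := out (hs L))) (hs (out (hs L))) \<subseteq> rsem G r (\<rho>(X := out (hs L))) (hs L)"
      by (rule rsem_mono) (auto intro: subsetD[OF mono_hs[OF \<open>out (hs L) \<subseteq> L\<close>]])
    then show "rsem G r (\<rho>(X := out (hs L))) (hs (out (hs L))) \<subseteq> out (hs L)"
      unfolding out_eq .
  qed
qed

lemma step_hs_L: "q \<in> Q \<Longrightarrow> step (hs L) q = hs L q"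
  using hs[of q L] by (simp add: step_eq out_hs_L)

text \<open>Outside \<open>F\<close> a state is decided by its successors, which precede it in a well-founded order.\<close>

lemma complete_if_no_progress:
  assumes closed: "\<And>q. q \<in> Q \<Longrightarrow> step S q \<subseteq> S q"
    and no_progress: "\<And>q. q \<in> Q \<Longrightarrow> hs (out S) q \<inter> F \<subseteq> S q"
  shows "L \<subseteq> out S"
proof -
  let ?E = "(\<Union>a. edges G a) \<inter> (verts G - F) \<times> (verts G - F)"
  have "?E \<subseteq> verts G \<times> verts G" by auto
  then have "finite ?E" using F(1) finite_subset by blast
  then have wf: "wf (?E\<inverse>)"
    using F(2) by (intro finite_acyclic_wf_converse) (simp_all only: feedback_vertex_set_def)
  have hs_verts: "hs (out S) q \<subseteq> verts G" if "q \<in> Q" for q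
    unfolding hs[OF that] by (rule rsem_subset_verts)
  have "v \<in> S q" if "v \<in> hs (out S) q" "q \<in> Q" for v q
    using wf that
  proof (induction v arbitrary: q)
    case (less v)
    show ?case
    proof (cases "v \<in> F")
      case True
      then show ?thesis using less.prems no_progress by blast
    next
      case False
      have "v \<in> rsem G (R q) (\<rho>(X := out S)) (hs (out S))"
        using less.prems hs[OF less.prems(2), of "out S"] by simp
      then have "v \<in> rsem G (R q) (\<rho>(X := out S)) S"
      proof (rule rsem_local)
        fix q' a w assume w: "q' \<in> states (R q)" "(v, w) \<in> edges G a" "w \<in> hs (out S) q'"
        have "q' \<in> Q" using w(1) Q(3) less.prems by blast
        show "w \<in> S q'"
        proof (cases "w \<in> F")
          case True
          then show ?thesis using w(3) \<open>q' \<in> Q\<close> no_progress by blast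
        next
          case False
          have "v \<in> verts G" using hs_verts[OF less.prems(2)] less.prems(1) by (rule subsetD)
          moreover have "w \<in> verts G" using hs_verts[OF \<open>q' \<in> Q\<close>] w(3) by (rule subsetD)
          ultimately have "(w, v) \<in> ?E\<inverse>" using w(2) False \<open>v \<notin> F\<close> by auto
          then show ?thesis using less.IH[OF _ w(3) \<open>q' \<in> Q\<close>] by blast
        qed
      qed simp
      \<comment> \<open>By \<open>step_eq\<close> the set obtained is \<open>step S q\<close>, below
        \<open>S q\<close> by closedness.\<close>
      then show ?thesis using closed[OF less.prems(2)] by (auto simp: step_eq)
    qed
  qed
  \<comment> \<open>Now \<open>hs (out S)\<close> is below \<open>S\<close> everywhere, so
    \<open>out S\<close> is a pre-fixed point of the operator whose least one is
    \<open>L\<close>.\<close>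
  then have "rsem G r (\<rho>(X := out S)) (hs (out S)) \<subseteq> rsem G r (\<rho>(X := out S)) S"
    using Q(2) by (intro rsem_mono) auto
  then show ?thesis unfolding out_eq by (rule L_lowerbound)
qed

text \<open>The potential \<open>m i\<close> counts the pairs of a state \<open>q\<close> and a
  vertex of \<open>F\<close> in \<open>S i q\<close>. By \<open>complete_if_no_progress\<close> it
  grows until \<open>L\<close> is covered, and it never exceeds \<open>card F * card Q\<close>. The
  other inclusion is soundness combined with \<open>out_hs_L\<close>.\<close>

lemma stages_converge:
  assumes incr: "\<And>i q. q \<in> Q \<Longrightarrow> S i q \<union> hs (out (S i)) q \<subseteq> S (Suc i) q"
    and closed: "\<And>i q. q \<in> Q \<Longrightarrow> step (S (Suc i)) q \<subseteq> S (Suc i) q"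
    and sound: "\<And>i q. q \<in> Q \<Longrightarrow> S i q \<subseteq> hs L q"
  shows "out (S (card F * card Q + 2)) = L"
proof
  have finF: "finite F" using F finite_subset by (auto simp: feedback_vertex_set_def)
  define m where "m i = (\<Sum>q\<in>Q. card (S i q \<inter> F))" for i
  have m_bound: "m i \<le> card F * card Q" for i
  proof -
    have "m i \<le> (\<Sum>q\<in>Q. card F)"
      unfolding m_def by (intro sum_mono card_mono finF) auto
    then show ?thesis by (simp add: mult.commute)
  qed
  \<comment> \<open>Stage \<open>S 0\<close> need not be closed under \<open>step\<close>, so
    counting starts at \<open>S (Suc 0)\<close>.\<close>
  have "L \<subseteq> out (S (Suc i)) \<or> i \<le> m (Suc i)" for i
  proof (induction i)
    case (Suc i)
    show ?case
    proof (cases "L \<subseteq> out (S (Suc i))")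
      case True
      moreover have "out (S (Suc i)) \<subseteq> out (S (Suc (Suc i)))"
        using incr[of _ "Suc i"] by (intro out_mono) simp
      ultimately show ?thesis by blast
    next
      case False
      have "\<exists>q\<in>Q. \<not> hs (out (S (Suc i))) q \<inter> F \<subseteq> S (Suc i) q"
      proof (rule ccontr)
        assume "\<not> ?thesis"
        then have "L \<subseteq> out (S (Suc i))" by (intro complete_if_no_progress closed) auto
        then show False using \<open>\<not> L \<subseteq> out (S (Suc i))\<close> by contradiction
      qed
      then obtain q where q: "q \<in> Q" "\<not> hs (out (S (Suc i))) q \<inter> F \<subseteq> S (Suc i) q" by blast
      have le: "S (Suc i) q \<inter> F \<subseteq> S (Suc (Suc i)) q \<inter> F" if "q \<in> Q" for q
        using incr[OF that, of "Suc i"] by blast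
      have "m (Suc i) < m (Suc (Suc i))"
        unfolding m_def
      proof (rule sum_strict_mono_ex1)
        show "\<forall>q\<in>Q. card (S (Suc i) q \<inter> F) \<le> card (S (Suc (Suc i)) q \<inter> F)"
          using le finF by (simp add: card_mono)
        have "S (Suc i) q \<inter> F \<subset> S (Suc (Suc i)) q \<inter> F"
          using q incr[OF q(1), of "Suc i"] by blast
        then show "\<exists>q\<in>Q. card (S (Suc i) q \<inter> F) < card (S (Suc (Suc i)) q \<inter> F)"
          using q(1) finF by (meson finite_Int psubset_card_mono)
      qed (rule Q(1))
      then show ?thesis using Suc False by linarith
    qed
  qed simp
  \<comment> \<open>This index exceeds the bound on \<open>m\<close>, which leaves only the first
    alternative and explains the \<open>+ 2\<close>.\<close>
  from this[of "Suc (card F * card Q)"] m_bound[of "Suc (Suc (card F * card Q))"]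
  show "L \<subseteq> out (S (card F * card Q + 2))" by auto
  have "out (S (card F * card Q + 2)) \<subseteq> out (hs L)" using sound by (rule out_mono)
  then show "out (S (card F * card Q + 2)) \<subseteq> L" by (simp add: out_hs_L)
qed

end

section \<open>Representation of formulas by systems\<close>

text \<open>\<open>N\<close> lists the variables to be avoided as states and as bound variables of the solution, which
  lets systems be combined and substituted into one another without renaming.\<close>

locale representation =
  fixes U :: "('v, 'p, 'a) graph set" and N :: "nat set" and \<phi> :: "('p, 'a) fml"
    and Q :: "nat set" and R :: "nat \<Rightarrow> ('p, 'a) rhs" and h :: "nat \<Rightarrow> ('p, 'a) fml"
    and r :: "('p, 'a) rhs"
  assumes finite_Q: "finite Q" and Q_N: "Q \<inter> N = {}"
    and states_r: "states r \<subseteq> Q" and params_r: "params r \<subseteq> fv \<phi>"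
    and states_R: "q \<in> Q \<Longrightarrow> states (R q) \<subseteq> Q" and params_R: "q \<in> Q \<Longrightarrow> params (R q) \<subseteq> fv \<phi>"
    and stratified_h: "q \<in> Q \<Longrightarrow> stratified (h q)"
    and fv_h: "q \<in> Q \<Longrightarrow> fv (h q) \<subseteq> fv \<phi>" and bv_h: "q \<in> Q \<Longrightarrow> bv (h q) \<inter> N = {}"
    and sem_r: "G \<in> U \<Longrightarrow> sem G \<phi> \<rho> = rsem G r \<rho> (\<lambda>q. sem G (h q) \<rho>)"
    and sem_h: "G \<in> U \<Longrightarrow> q \<in> Q \<Longrightarrow> sem G (h q) \<rho> = rsem G (R q) \<rho> (\<lambda>q. sem G (h q) \<rho>)"

text \<open>One system and one family of solution formulas serve all graphs of \<open>U\<close> and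
  all valuations.\<close>

definition representable :: "('v, 'p, 'a) graph set \<Rightarrow> ('p, 'a) fml \<Rightarrow> bool" where
  "representable U \<phi> \<longleftrightarrow> (\<forall>N. finite N \<longrightarrow> (\<exists>Q R h r. representation U N \<phi> Q R h r))"

section \<open>Closure under duality, conjunction and box\<close>

lemma representableI:
  "(\<And>N. finite N \<Longrightarrow> \<exists>Q R h r. representation U N \<phi> Q R h r) \<Longrightarrow> representable U \<phi>"
  by (simp add: representable_def)

lemma representableE:
  assumes "representable U \<phi>" "finite N"
  obtains Q R h r where "representation U N \<phi> Q R h r"
  using assms by (auto simp: representable_def)

text \<open>Dualising the equations and the solution formulas complements all values. As
  \<open>h\<close> is merely some solution, no extremality has to be transferred.\<close>

lemma representable_dual:
  fixes \<phi> :: "('p, 'a) fml" and U :: "('v, 'p, 'a) graph set"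
  assumes U: "\<And>G. G \<in> U \<Longrightarrow> is_graph G" and "representable U \<phi>"
  shows "representable U (dual \<phi>)"
proof (rule representableI)
  fix N :: "nat set" assume "finite N"
  with assms(2) obtain Q R h r where "representation U N \<phi> Q R h r" by (rule representableE)
  then interpret representation U N \<phi> Q R h r .
  have h: "(\<lambda>q. verts G - sem G (dual (h q)) \<rho>) = (\<lambda>q. sem G (h q) (\<lambda>X. verts G - \<rho> X))"
    if "G \<in> U" for G :: "('v, 'p, 'a) graph" and \<rho>
    unfolding sem_dual[OF U[OF that]] by (simp add: double_diff sem_subset_verts)
  have "representation U N (dual \<phi>) Q (\<lambda>q. rdual (R q)) (\<lambda>q. dual (h q)) (rdual r)"
  proof
    show "sem G (dual \<phi>) \<rho> = rsem G (rdual r) \<rho> (\<lambda>q. sem G (dual (h q)) \<rho>)" if "G \<in> U" for G \<rho>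
      unfolding rsem_rdual[OF U[OF that]] h[OF that] sem_dual[OF U[OF that], of \<phi>] sem_r[OF that] ..
    show "sem G (dual (h q)) \<rho> = rsem G (rdual (R q)) \<rho> (\<lambda>q. sem G (dual (h q)) \<rho>)"
      if "G \<in> U" "q \<in> Q" for G \<rho> q
      unfolding rsem_rdual[OF U[OF that(1)]] h[OF that(1)]
      by (subst sem_dual[OF U[OF that(1)]], subst sem_h[OF that]) (rule refl)
  qed (simp_all add: finite_Q Q_N states_r params_r states_R params_R stratified_h fv_h bv_h)
  then show "\<exists>Q R h r. representation U N (dual \<phi>) Q R h r" by blast
qed

lemma representable_Var: "representable U (Var X)"
proof (rule representableI)
  have "representation U N (Var X) {} (\<lambda>_. RVar X) Var (RVar X)" for N
    by unfold_locales auto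
  then show "\<exists>Q R h r. representation U N (Var X) Q R h r" for N by blast
qed

lemma representable_Prop: "representable U (Prop p)"
proof (rule representableI)
  have "representation U N (Prop p) {} (\<lambda>_. RProp p) Var (RProp p)" for N
    by unfold_locales auto
  then show "\<exists>Q R h r. representation U N (Prop p) Q R h r" for N by blast
qed

lemma representable_Conj:
  fixes \<phi> \<psi> :: "('p, 'a) fml" and U :: "('v, 'p, 'a) graph set"
  assumes "representable U \<phi>" "representable U \<psi>"
  shows "representable U (Conj \<phi> \<psi>)"
proof (rule representableI)
  fix N :: "nat set" assume "finite N"
  with assms(1) obtain Q R h r where "representation U N \<phi> Q R h r" by (rule representableE)
  then interpret A: representation U N \<phi> Q R h r .
  \<comment> \<open>The second system also avoids the states of the first, so that the two can be
    united.\<close>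
  have "finite (N \<union> Q)" using \<open>finite N\<close> A.finite_Q by simp
  with assms(2) obtain Q' R' h' r' where "representation U (N \<union> Q) \<psi> Q' R' h' r'"
    by (rule representableE)
  then interpret B: representation U "N \<union> Q" \<psi> Q' R' h' r' .
  define R'' where "R'' = override_on R' R Q"
  define h'' where "h'' = override_on h' h Q"
  have h: "\<And>q. q \<in> Q \<Longrightarrow> h'' q = h q" "\<And>q. q \<in> Q' \<Longrightarrow> h'' q = h' q"
    and R: "\<And>q. q \<in> Q \<Longrightarrow> R'' q = R q" "\<And>q. q \<in> Q' \<Longrightarrow> R'' q = R' q"
    using B.Q_N by (auto simp: R''_def h''_def override_on_def)
  have rsem: "rsem G s \<rho> (\<lambda>q. sem G (h'' q) \<rho>) = rsem G s \<rho> (\<lambda>q. sem G (h q) \<rho>)"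
    if "states s \<subseteq> Q" for G :: "('v, 'p, 'a) graph" and \<rho> s
    by (rule rsem_cong) (use that h in auto)
  have rsem': "rsem G s \<rho> (\<lambda>q. sem G (h'' q) \<rho>) = rsem G s \<rho> (\<lambda>q. sem G (h' q) \<rho>)"
    if "states s \<subseteq> Q'" for G :: "('v, 'p, 'a) graph" and \<rho> s
    by (rule rsem_cong) (use that h in auto)
  have "representation U N (Conj \<phi> \<psi>) (Q \<union> Q') R'' h'' (RConj r r')"
  proof
    show "finite (Q \<union> Q')" "(Q \<union> Q') \<inter> N = {}"
      using A.finite_Q B.finite_Q A.Q_N B.Q_N by auto
    show "states (RConj r r') \<subseteq> Q \<union> Q'" "params (RConj r r') \<subseteq> fv (Conj \<phi> \<psi>)"
      using A.states_r B.states_r A.params_r B.params_r by auto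
    show "sem G (Conj \<phi> \<psi>) \<rho> = rsem G (RConj r r') \<rho> (\<lambda>q. sem G (h'' q) \<rho>)" if "G \<in> U" for G \<rho>
      using A.sem_r B.sem_r that by (simp add: rsem[OF A.states_r] rsem'[OF B.states_r])
    fix q assume "q \<in> Q \<union> Q'"
    then have "states (R'' q) \<subseteq> Q \<union> Q' \<and> params (R'' q) \<subseteq> fv (Conj \<phi> \<psi>) \<and> stratified (h'' q) \<and>
      fv (h'' q) \<subseteq> fv (Conj \<phi> \<psi>) \<and> bv (h'' q) \<inter> N = {} \<and>
      (\<forall>G\<in>U. \<forall>\<rho>. sem G (h'' q) \<rho> = rsem G (R'' q) \<rho> (\<lambda>q. sem G (h'' q) \<rho>))"
    proof
      assume q: "q \<in> Q"
      show ?thesis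
        using A.states_R[OF q] A.params_R[OF q] A.stratified_h[OF q] A.fv_h[OF q] A.bv_h[OF q] A.sem_h[OF _ q]
        by (auto simp: h(1)[OF q] R(1)[OF q] rsem[OF A.states_R[OF q]])
    next
      assume q: "q \<in> Q'"
      show ?thesis
        using B.states_R[OF q] B.params_R[OF q] B.stratified_h[OF q] B.fv_h[OF q] B.bv_h[OF q] B.sem_h[OF _ q]
        by (auto simp: h(2)[OF q] R(2)[OF q] rsem'[OF B.states_R[OF q]])
    qed
    then show "states (R'' q) \<subseteq> Q \<union> Q'" "params (R'' q) \<subseteq> fv (Conj \<phi> \<psi>)" "stratified (h'' q)"
      "fv (h'' q) \<subseteq> fv (Conj \<phi> \<psi>)" "bv (h'' q) \<inter> N = {}"
      "\<And>G \<rho>. G \<in> U \<Longrightarrow> sem G (h'' q) \<rho> = rsem G (R'' q) \<rho> (\<lambda>q. sem G (h'' q) \<rho>)"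
      by blast+
  qed
  then show "\<exists>Q R h r. representation U N (Conj \<phi> \<psi>) Q R h r" by blast
qed

text \<open>Only a state may stand below a modality, so a fresh state \<open>n\<close> is added to
  name the value of \<open>\<phi>\<close>, with equation \<open>r\<close> and solution
  \<open>fml_of h r\<close>.\<close>

lemma representable_Box:
  fixes \<phi> :: "('p, 'a) fml" and U :: "('v, 'p, 'a) graph set"
  assumes "representable U \<phi>"
  shows "representable U (Box a \<phi>)"
proof (rule representableI)
  fix N :: "nat set" assume "finite N"
  with assms obtain Q R h r where "representation U N \<phi> Q R h r" by (rule representableE)
  then interpret representation U N \<phi> Q R h r .
  have "finite (N \<union> Q)" using \<open>finite N\<close> finite_Q by simp
  then obtain n where n: "n \<notin> N \<union> Q" using ex_new_if_finite by (metis infinite_UNIV_nat)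
  define h' where "h' = h(n := fml_of h r)"
  have h': "h' n = fml_of h r" "\<And>q. q \<in> Q \<Longrightarrow> h' q = h q" using n by (auto simp: h'_def)
  define R' where "R' = R(n := r)"
  have R': "R' n = r" "\<And>q. q \<in> Q \<Longrightarrow> R' q = R q" using n by (auto simp: R'_def)
  have rsem: "rsem G s \<rho> (\<lambda>q. sem G (h' q) \<rho>) = rsem G s \<rho> (\<lambda>q. sem G (h q) \<rho>)"
    if "states s \<subseteq> Q" for G :: "('v, 'p, 'a) graph" and \<rho> s
    by (rule rsem_cong) (use that h' in auto)
  have "representation U N (Box a \<phi>) (insert n Q) R' h' (RBox a n)"
  proof
    show "finite (insert n Q)" "insert n Q \<inter> N = {}" using finite_Q Q_N n by auto
    show "states (RBox a n) \<subseteq> insert n Q" "params (RBox a n) \<subseteq> fv (Box a \<phi>)" by auto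
    show "sem G (Box a \<phi>) \<rho> = rsem G (RBox a n) \<rho> (\<lambda>q. sem G (h' q) \<rho>)" if "G \<in> U" for G \<rho>
      by (simp add: h' sem_fml_of sem_r[OF that])
    fix q assume "q \<in> insert n Q"
    then have "states (R' q) \<subseteq> insert n Q \<and> params (R' q) \<subseteq> fv (Box a \<phi>) \<and> stratified (h' q) \<and>
      fv (h' q) \<subseteq> fv (Box a \<phi>) \<and> bv (h' q) \<inter> N = {} \<and>
      (\<forall>G\<in>U. \<forall>\<rho>. sem G (h' q) \<rho> = rsem G (R' q) \<rho> (\<lambda>q. sem G (h' q) \<rho>))"
    proof
      assume q: "q = n"
      have "stratified (fml_of h r)" using states_r stratified_h by (auto simp: stratified_fml_of)
      moreover have "fv (fml_of h r) \<subseteq> fv \<phi>"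
        using states_r fv_h params_r by (fastforce simp: fv_fml_of)
      moreover have "bv (fml_of h r) \<inter> N = {}"
        using states_r bv_h by (fastforce simp: bv_fml_of)
      ultimately show ?thesis
        using states_r params_r by (auto simp: q h' R' rsem sem_fml_of)
    next
      assume q: "q \<in> Q"
      show ?thesis
        using states_R[OF q] params_R[OF q] stratified_h[OF q] fv_h[OF q] bv_h[OF q] sem_h[OF _ q]
        by (auto simp: h'(2)[OF q] R'(2)[OF q] rsem[OF states_R[OF q]])
    qed
    then show "states (R' q) \<subseteq> insert n Q" "params (R' q) \<subseteq> fv (Box a \<phi>)" "stratified (h' q)"
      "fv (h' q) \<subseteq> fv (Box a \<phi>)" "bv (h' q) \<inter> N = {}"
      "\<And>G \<rho>. G \<in> U \<Longrightarrow> sem G (h' q) \<rho> = rsem G (R' q) \<rho> (\<lambda>q. sem G (h' q) \<rho>)"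
      by blast+
  qed
  then show "\<exists>Q R h r. representation U N (Box a \<phi>) Q R h r" by blast
qed

text \<open>The new equations are the old ones with \<open>X\<close> tied to its own value. The
  solution is built syntactically from finitely many stages and verified in each graph by
  \<open>system_fixpoint\<close>; the number of stages depends only on \<open>k\<close> and
  \<open>card Q\<close>, hence the formulas are uniform over \<open>U\<close>.\<close>

lemma representable_Mu:
  fixes \<phi> :: "('p, 'a) fml" and U :: "('v, 'p, 'a) graph set"
  assumes U: "\<And>G. G \<in> U \<Longrightarrow> finite (verts G) \<and> (\<exists>F. feedback_vertex_set G F \<and> card F = k)"
    and \<phi>: "representable U \<phi>"
  shows "representable U (Mu X \<phi>)"
proof (rule representableI)
  fix N :: "nat set" assume "finite N"
  define M where "M = insert X (N \<union> fv \<phi>)"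
  have "finite M" using \<open>finite N\<close> by (simp add: M_def finite_fv)
  with \<phi> obtain Q R h r where "representation U M \<phi> Q R h r" by (rule representableE)
  then interpret representation U M \<phi> Q R h r .
  define r' where "r' = rsubst r X rfalse"
  define R' where "R' q = rsubst (R q) X r'" for q
  have states_r': "states r' \<subseteq> Q" and params_r': "params r' \<subseteq> fv \<phi> - {X}"
    using states_rsubst[of r X rfalse] params_rsubst[of r X rfalse] states_r params_r
    by (auto simp: r'_def)
  have states_R': "states (R' q) \<subseteq> Q" and params_R': "params (R' q) \<subseteq> fv \<phi> - {X}" if "q \<in> Q" for q
    using states_rsubst[of "R q" X r'] params_rsubst[of "R q" X r'] states_R[OF that] params_R[OF that]
      states_r' params_r' by (auto simp: R'_def)
  \<comment> \<open>All names in use are below \<open>C\<close>, so the variables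
    \<open>q + C\<close> are fresh and pairwise distinct.\<close>
  obtain C where C: "\<And>n. n \<in> Q \<union> M \<Longrightarrow> n < C"
    using finite_nat_set_iff_bounded[of "Q \<union> M"] \<open>finite M\<close> finite_Q by auto
  \<comment> \<open>The variable \<open>q + C\<close> is a placeholder for the lower bound that the next stage of \<open>q\<close> must exceed.\<close>
  define g where "g q = Disj (Var (q + C)) (fml_of Var (R' q))" for q
  define P where "P = (fv \<phi> - {X}) \<union> (\<lambda>q. q + C) ` Q"
  have "mu_free (dual (g q)) \<and> fv (g q) \<subseteq> P \<union> Q \<and> bv (g q) = {}" if "q \<in> Q" for q
    using states_R'[OF that] params_R'[OF that] that
    by (auto simp: g_def P_def mu_free_dual_fml_of fv_fml_of bv_fml_of)
  moreover have "Q \<inter> P = {}" using Q_N C by (fastforce simp: P_def M_def)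
  ultimately obtain e where
    e: "\<And>q. q \<in> Q \<Longrightarrow> mu_free (dual (e q))" "\<And>q. q \<in> Q \<Longrightarrow> fv (e q) \<subseteq> P" "\<And>q. q \<in> Q \<Longrightarrow> bv (e q) \<subseteq> Q"
    and e_closed: "\<And>(G :: ('v, 'p, 'a) graph) \<rho> q. q \<in> Q \<Longrightarrow>
      sem G (g q) (override_on \<rho> (\<lambda>q. sem G (e q) \<rho>) Q) \<subseteq> sem G (e q) \<rho>"
    and e_least: "\<And>(G :: ('v, 'p, 'a) graph) \<rho> S q. (\<And>q. q \<in> Q \<Longrightarrow>
      sem G (g q) (override_on \<rho> S Q) \<subseteq> S q) \<Longrightarrow> q \<in> Q \<Longrightarrow> sem G (e q) \<rho> \<subseteq> S q"
    using least_solution[OF finite_Q, of g P] by metis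

  \<comment> \<open>If \<open>s\<close> denotes the family \<open>S\<close>, then \<open>H s\<close>
    denotes \<open>hs (out S)\<close>. The substitution \<open>\<tau> s\<close> fills the
    placeholder \<open>q + C\<close> with the join of both at \<open>q\<close>, so
    \<open>\<Phi>\<close> maps one stage to the next, starting from falsity.\<close>
  define H where "H s q = msubst (Var(X := fml_of s r')) (h q)" for s q
  define \<tau> where "\<tau> s Y = (if Y < C then Var Y else Disj (s (Y - C)) (H s (Y - C)))" for s Y
  define \<Phi> where "\<Phi> s q = msubst (\<tau> s) (e q)" for s q
  define stage where "stage i = (\<Phi> ^^ i) (\<lambda>_. fml_of Var rfalse)" for i
  \<comment> \<open>The invariant of all stages. Free variables lie in \<open>M\<close> and bound
    ones outside it, which keeps the substitutions into \<open>h\<close> and \<open>e\<close>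
    capture-free.\<close>
  define good where "good \<chi> \<longleftrightarrow> stratified \<chi> \<and> fv \<chi> \<subseteq> fv \<phi> - {X} \<and> bv \<chi> \<inter> M = {}"
    for \<chi> :: "('p, 'a) fml"
  have stage_Suc: "stage (Suc i) = \<Phi> (stage i)" for i
    by (simp add: stage_def)

  have good_out: "good (fml_of s r')" if s: "\<And>q. q \<in> Q \<Longrightarrow> good (s q)" for s
  proof -
    have "good (s q)" if "q \<in> states r'" for q using s states_r' that by auto
    then show ?thesis using params_r'
      unfolding good_def stratified_fml_of fv_fml_of bv_fml_of by blast
  qed
  have capture_free_H: "capture_free (Var(X := fml_of s r')) (h q)"
    if s: "\<And>q. q \<in> Q \<Longrightarrow> good (s q)" and q: "q \<in> Q" for s q
  proof -
    have "fv (fml_of s r') \<subseteq> M" using good_out[of s, OF s] by (auto simp: good_def M_def)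
    then show ?thesis using bv_h[OF q] by (auto simp: capture_free_def)
  qed
  have good_H: "good (H s q)" if s: "\<And>q. q \<in> Q \<Longrightarrow> good (s q)" and q: "q \<in> Q" for s q
  proof -
    have o: "stratified (fml_of s r')" "fv (fml_of s r') \<subseteq> fv \<phi> - {X}" "bv (fml_of s r') \<inter> M = {}"
      using good_out[of s, OF s] by (auto simp: good_def)
    have "stratified (H s q)"
      unfolding H_def
      by (rule stratified_msubst[OF stratified_h[OF q] _ capture_free_H[of s, OF s q]]) (simp_all add: o)
    moreover have "fv (H s q) \<subseteq> fv \<phi> - {X}"
      using fv_msubst[of "Var(X := fml_of s r')" "h q"] fv_h[OF q] o(2)
      unfolding H_def by (fastforce split: if_splits)
    moreover have "bv (H s q) \<inter> M = {}"
      using bv_msubst[of "Var(X := fml_of s r')" "h q"] bv_h[OF q] o(3)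
      unfolding H_def by (fastforce split: if_splits)
    ultimately show ?thesis by (simp add: good_def)
  qed
  have fv_e: "Y < C \<or> Y - C \<in> Q" if "q \<in> Q" "Y \<in> fv (e q)" for q Y
    using e(2)[OF that(1)] that(2) C by (auto simp: P_def M_def)
  have good_\<tau>: "stratified (\<tau> s Y) \<and> (Y < C \<or> fv (\<tau> s Y) \<subseteq> fv \<phi> - {X}) \<and> bv (\<tau> s Y) \<inter> M = {}"
    if s: "\<And>q. q \<in> Q \<Longrightarrow> good (s q)" and Y: "q \<in> Q" "Y \<in> fv (e q)" for s q Y
  proof (cases "Y < C")
    case False
    then have "Y - C \<in> Q" using fv_e[OF Y] by simp
    then show ?thesis using s[of "Y - C"] good_H[of s, OF s, of "Y - C"] False
      by (auto simp: \<tau>_def good_def)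
  qed (simp add: \<tau>_def)
  have capture_free_\<Phi>: "capture_free (\<tau> s) (e q)"
    if s: "\<And>q. q \<in> Q \<Longrightarrow> good (s q)" and q: "q \<in> Q" for s q
    unfolding capture_free_def
  proof
    fix Y assume Y: "Y \<in> fv (e q)"
    show "\<tau> s Y = Var Y \<or> bv (e q) \<inter> fv (\<tau> s Y) = {}"
    proof (cases "Y < C")
      case True
      then show ?thesis by (simp add: \<tau>_def)
    next
      case False
      then show ?thesis using good_\<tau>[of s, OF s q Y] e(3)[OF q] Q_N by (auto simp: M_def)
    qed
  qed
  have good_\<Phi>: "good (\<Phi> s q)" if s: "\<And>q. q \<in> Q \<Longrightarrow> good (s q)" and q: "q \<in> Q" for s q
  proof -
    \<comment> \<open>\<open>e q\<close> is a pure \<mu>-formula and thus stratified; substituting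
      stratified formulas for its free variables preserves this, whatever fixpoints they
      contain.\<close>
    have "stratified (\<Phi> s q)"
      unfolding \<Phi>_def using good_\<tau>[of s, OF s q]
      by (intro stratified_msubst[OF stratified_if_mu_free_dual[OF e(1)[OF q]] _ capture_free_\<Phi>[of s, OF s q]]) auto
    moreover have "fv (\<tau> s Y) \<subseteq> fv \<phi> - {X}" if "Y \<in> fv (e q)" for Y
    proof (cases "Y < C")
      case True
      then have "Y \<in> fv \<phi> - {X}" using that e(2)[OF q] by (auto simp: P_def)
      then show ?thesis using True by (simp add: \<tau>_def)
    qed (use good_\<tau>[of s, OF s q that] in simp)
    then have "fv (\<Phi> s q) \<subseteq> fv \<phi> - {X}"
      using fv_msubst[of "\<tau> s" "e q"] unfolding \<Phi>_def by blast
    moreover have "bv (\<Phi> s q) \<inter> M = {}"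
      using bv_msubst[of "\<tau> s" "e q"] good_\<tau>[of s, OF s q] e(3)[OF q] Q_N
      unfolding \<Phi>_def by blast
    ultimately show ?thesis by (simp add: good_def)
  qed
  have good_stage: "good (stage i q)" if "q \<in> Q" for i q
    using that
  proof (induction i arbitrary: q)
    case 0
    show ?case by (simp add: stage_def good_def stratified_fml_of fv_fml_of bv_fml_of)
  next
    case (Suc i)
    show ?case unfolding stage_Suc by (rule good_\<Phi>) (use Suc in auto)
  qed

  \<comment> \<open>The bound of \<open>stages_converge\<close> with \<open>card F = k\<close>, the
    same for every graph of \<open>U\<close>.\<close>
  define s where "s = stage (k * card Q + 2)"
  have fixpoint: "sem G (Mu X \<phi>) \<rho> = rsem G r' \<rho> (\<lambda>q. sem G (H s q) \<rho>) \<and>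
      (\<forall>q\<in>Q. sem G (H s q) \<rho> = rsem G (R' q) \<rho> (\<lambda>q. sem G (H s q) \<rho>))" if G: "G \<in> U" for G \<rho>
  proof -
    obtain F where fvs: "finite (verts G)" "feedback_vertex_set G F" "card F = k" using U[OF G] by auto
    define hs where "hs A q = sem G (h q) (\<rho>(X := A))" for A q
    define L where "L = lfp (\<lambda>A. rsem G r (\<rho>(X := A)) (hs A))"
    define S where "S i q = sem G (stage i q) \<rho>" for i q
    interpret system_fixpoint G F \<rho> X Q R r hs L
    proof
      show "hs A q = rsem G (R q) (\<rho>(X := A)) (hs A)" if "q \<in> Q" for A q
        unfolding hs_def by (rule sem_h[OF G that])
      show "hs A q \<subseteq> hs B q" if "A \<subseteq> B" for A B q
        unfolding hs_def by (rule sem_mono) (use that in auto)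
    qed (use fvs finite_Q states_r states_R in \<open>auto simp: L_def\<close>)
    note out_hs_L = out_hs_L[folded r'_def] and out_mono = out_mono[folded r'_def]
    have step_hs_L: "rsem G (R' q) \<rho> (hs L) = hs L q" if "q \<in> Q" for q
      unfolding R'_def r'_def by (rule step_hs_L[OF that])
    have sem_L: "sem G (Mu X \<phi>) \<rho> = L"
      by (simp add: L_def hs_def[abs_def] sem_r[OF G])
    have out_S: "sem G (fml_of (stage i) r') \<rho> = rsem G r' \<rho> (S i)" for i
      by (simp add: sem_fml_of S_def[abs_def])
    have sem_H: "sem G (H (stage i) q) \<rho> = hs (rsem G r' \<rho> (S i)) q" if "q \<in> Q" for i q
    proof -
      have "capture_free (Var(X := fml_of (stage i) r')) (h q)"
        by (rule capture_free_H) (use good_stage that in auto)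
      from sem_msubst[OF this, of G \<rho>] show ?thesis
        unfolding sem_fun_upd_Var H_def hs_def out_S .
    qed
    define \<rho>' where "\<rho>' i Y = sem G (\<tau> (stage i) Y) \<rho>" for i Y
    have S_Suc: "S (Suc i) q = sem G (e q) (\<rho>' i)" if "q \<in> Q" for i q
    proof -
      have "capture_free (\<tau> (stage i)) (e q)"
        by (rule capture_free_\<Phi>) (use good_stage that in auto)
      from sem_msubst[OF this, of G \<rho>] show ?thesis
        unfolding S_def stage_Suc \<Phi>_def \<rho>'_def .
    qed
    \<comment> \<open>\<open>T\<close> must lie within \<open>verts G\<close> because
      \<open>sem\<close> clips variables.\<close>
    have sem_g: "sem G (g q) (override_on (\<rho>' i) T Q) =
        S i q \<union> hs (rsem G r' \<rho> (S i)) q \<union> rsem G (R' q) \<rho> T"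
      if q: "q \<in> Q" and T: "\<And>q. q \<in> Q \<Longrightarrow> T q \<subseteq> verts G" for i q T
    proof -
      have "q + C \<notin> Q" using C[of "q + C"] by auto
      then have "sem G (Var (q + C)) (override_on (\<rho>' i) T Q) = S i q \<union> hs (rsem G r' \<rho> (S i)) q"
        using sem_subset_verts[of G "\<tau> (stage i) (q + C)" \<rho>] sem_H[OF q, of i]
        by (auto simp: \<rho>'_def \<tau>_def S_def)
      moreover have "sem G (fml_of Var (R' q)) (override_on (\<rho>' i) T Q) = rsem G (R' q) \<rho> T"
        unfolding sem_fml_of
      proof (rule rsem_cong)
        fix Y assume "Y \<in> params (R' q)"
        then have "Y \<in> M" using params_R'[OF q] by (auto simp: M_def)
        then have "Y \<notin> Q" "Y < C" using Q_N C by auto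
        then show "override_on (\<rho>' i) T Q Y \<inter> verts G = \<rho> Y \<inter> verts G"
          by (simp add: \<rho>'_def \<tau>_def)
      next
        fix z assume "z \<in> states (R' q)"
        then have "z \<in> Q" using states_R'[OF q] by auto
        then show "sem G (Var z) (override_on (\<rho>' i) T Q) = T z" using T[of z] by auto
      qed
      ultimately show ?thesis by (simp add: g_def)
    qed
    have S_verts: "S i q \<subseteq> verts G" for i q unfolding S_def by (rule sem_subset_verts)
    have hs_verts: "hs A q \<subseteq> verts G" for A q unfolding hs_def by (rule sem_subset_verts)
    have closed: "S i q \<union> hs (rsem G r' \<rho> (S i)) q \<union> rsem G (R' q) \<rho> (S (Suc i)) \<subseteq> S (Suc i) q"
      if "q \<in> Q" for i q
    proof -
      have "override_on (\<rho>' i) (\<lambda>q. sem G (e q) (\<rho>' i)) Q = override_on (\<rho>' i) (S (Suc i)) Q"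
        by (auto simp: override_on_def S_Suc fun_eq_iff)
      then show ?thesis
        using e_closed[OF that, of G "\<rho>' i"] sem_g[OF that, of "S (Suc i)" i] S_verts S_Suc[OF that] by simp
    qed
    have sound: "S i q \<subseteq> hs L q" if "q \<in> Q" for i q
      using that
    proof (induction i arbitrary: q)
      case 0
      show ?case by (simp add: S_def stage_def sem_fml_of)
    next
      case (Suc i)
      have "rsem G r' \<rho> (S i) \<subseteq> L"
        using out_mono[of "S i" "hs L"] Suc.IH out_hs_L by simp
      then have "hs (rsem G r' \<rho> (S i)) q \<subseteq> hs L q" for q by (rule mono_hs)
      \<comment> \<open>\<open>hs L\<close> is closed under the equations of the next stage, as it
        is above \<open>S i\<close> and \<open>hs (out (S i))\<close> and is a fixed point of
        \<open>step\<close>; leastness of \<open>e\<close> then applies.\<close>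
      then have "sem G (g q) (override_on (\<rho>' i) (hs L) Q) \<subseteq> hs L q" if "q \<in> Q" for q
        using Suc.IH[OF that] step_hs_L[OF that] by (simp add: sem_g[OF that hs_verts])
      then show ?case unfolding S_Suc[OF Suc.prems] using Suc.prems by (rule e_least)
    qed
    have "rsem G r' \<rho> (S (card F * card Q + 2)) = L"
      by (rule stages_converge[folded r'_def]) (use closed sound in \<open>auto simp: R'_def\<close>)
    \<comment> \<open>Only \<open>out\<close> is known to have converged, while the stage
      \<open>s\<close> may still be below \<open>hs L\<close>. The solution is therefore
      \<open>H s\<close>, which re-evaluates \<open>h\<close> at \<open>X = L\<close>.\<close>
    then have sem_H_s: "sem G (H s q) \<rho> = hs L q" if "q \<in> Q" for q
      using sem_H[OF that] by (simp add: s_def fvs(3))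
    have rsem_H_s: "rsem G t \<rho> (\<lambda>q. sem G (H s q) \<rho>) = rsem G t \<rho> (hs L)" if "states t \<subseteq> Q" for t
      by (rule rsem_cong) (use that sem_H_s in auto)
    show ?thesis
      using sem_L out_hs_L step_hs_L rsem_H_s[OF states_r'] rsem_H_s[OF states_R'] sem_H_s by auto
  qed
  have "representation U N (Mu X \<phi>) Q R' (H s) r'"
  proof
    fix q assume q: "q \<in> Q"
    have "good (H s q)" unfolding s_def by (rule good_H) (use good_stage q in auto)
    then show "stratified (H s q)" "fv (H s q) \<subseteq> fv (Mu X \<phi>)" "bv (H s q) \<inter> N = {}"
      by (auto simp: good_def M_def)
    show "states (R' q) \<subseteq> Q" "params (R' q) \<subseteq> fv (Mu X \<phi>)"
      using states_R'[OF q] params_R'[OF q] by auto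
    show "sem G (H s q) \<rho> = rsem G (R' q) \<rho> (\<lambda>q. sem G (H s q) \<rho>)" if "G \<in> U" for G \<rho>
      using fixpoint[OF that] q by blast
  next
    show "sem G (Mu X \<phi>) \<rho> = rsem G r' \<rho> (\<lambda>q. sem G (H s q) \<rho>)" if "G \<in> U" for G \<rho>
      using fixpoint[OF that] by blast
  qed (use finite_Q Q_N states_r' params_r' in \<open>auto simp: M_def\<close>)
  then show "\<exists>Q R h r. representation U N (Mu X \<phi>) Q R h r" by blast
qed

text \<open>One operator of each dual pair is treated directly; the other is obtained by conjugation
  with the involution \<open>dual\<close>.\<close>

lemma representable:
  fixes \<phi> :: "('p, 'a) fml" and U :: "('v, 'p, 'a) graph set"
  assumes U: "\<And>G. G \<in> U \<Longrightarrow> is_graph G \<and> dag_decomposable k G"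
  shows "representable U \<phi>"
proof (induction \<phi>)
  case (Var X)
  show ?case by (rule representable_Var)
next
  case (Prop p)
  show ?case by (rule representable_Prop)
next
  case (NProp p)
  show ?case using representable_dual[OF _ representable_Prop[of U p]] U by simp
next
  case (Conj \<phi> \<psi>)
  then show ?case by (rule representable_Conj)
next
  case (Disj \<phi> \<psi>)
  then have "representable U (dual \<phi>)" "representable U (dual \<psi>)"
    using U by (auto intro: representable_dual)
  from representable_dual[OF _ representable_Conj[OF this]] show ?case using U by simp
next
  case (Box a \<phi>)
  then show ?case by (rule representable_Box)
next
  case (Dia a \<phi>)
  then have "representable U (dual \<phi>)" using U by (auto intro: representable_dual)
  from representable_dual[OF _ representable_Box[OF this]] show ?case using U by simp
next
  case (Mu X \<phi>)
  then show ?case using U by (intro representable_Mu[where k = k]) (auto simp: dag_decomposable_def)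
next
  case (Nu X \<phi>)
  then have "representable U (dual \<phi>)" using U by (auto intro: representable_dual)
  then have "representable U (Mu X (dual \<phi>))"
    using U by (intro representable_Mu[where k = k]) (auto simp: dag_decomposable_def)
  from representable_dual[OF _ this] show ?case using U by simp
qed

theorem theorem12:
  fixes k :: nat
    and U :: "('v, 'p::finite, 'a::finite) graph set"
    and \<phi> :: "('p, 'a) fml"
  assumes "\<And>G. G \<in> U \<Longrightarrow> is_graph G \<and> dag_decomposable k G"
    and "sentence \<phi>"
  shows "\<exists>\<psi> :: ('p, 'a) fml. sentence \<psi> \<and> alternation_free \<psi> \<and> lang U \<psi> = lang U \<phi>"
proof -
  from representable[OF assms(1)] finite.emptyI obtain Q R h r where "representation U {} \<phi> Q R h r"
    by (rule representableE)
  then interpret representation U "{}" \<phi> Q R h r .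
  \<comment> \<open>The witness is the output \<open>r\<close> with each state replaced by its
    solution formula; by \<open>sem_r\<close> it agrees with \<open>\<phi>\<close> on all of
    \<open>U\<close>.\<close>
  have "sentence (fml_of h r)"
    using assms(2) states_r params_r fv_h by (fastforce simp: sentence_def fv_fml_of)
  moreover have "alternation_free (fml_of h r)"
    using states_r stratified_h by (intro stratified_alternation_free) (auto simp: stratified_fml_of)
  moreover have "lang U (fml_of h r) = lang U \<phi>"
    by (auto simp: lang_def sem_fml_of sem_r)
  ultimately show ?thesis by blast
qed

end
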